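(* For all sufficiently large $d$, the polynomial $$P^{d,n}(X):=\sum_{j=0}^d \binom{d}{j}\gamma(n+j)\, H_{d-j}(X)$$ is hyperbolic (has only real zeros) whenever $n/\log^2 n \geq d^{3/4}/2$.
   Context: $\xi(s):=\tfrac12 s(s-1)\pi^{-s/2}\Gamma(s/2)\zeta(s)$ is the Riemann xi function and, for integers $m\ge0$, $\gamma(m):=\frac{m!}{(2m)!}\xi^{(2m)}(1/2)$. $H_d(X)$ is the $d$-th Hermite polynomial with generating function $\exp(2Xt-t^2)=\sum_{d\ge 0}H_d(X)t^d/d!$. Here $n\ge 0$ and $d\ge1$ are integers. *)

theory Defs
  imports "HOL-Complex_Analysis.Complex_Analysis"
begin

text \<open>The Riemann zeta function is the analytic continuation of its Dirichlet series to
  \<open>\<complex> - {1}\<close>; the value at the pole is fixed to be 0, which makes the description unique.\<close>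

definition riemann_zeta :: "complex \<Rightarrow> complex" where
  "riemann_zeta =
     (THE f. f holomorphic_on (- {1}) \<and>
             (\<forall>s. Re s > 1 \<longrightarrow> f s = (\<Sum>k. of_nat (Suc k) powr (- s))) \<and>
             f 1 = 0)"

text \<open>The defining product has removable singularities at 0, 1 and the negative even integers,
  where \<^const>\<open>Gamma\<close> and \<open>riemann_zeta\<close> take conventional values.\<close>

definition riemann_xi :: "complex \<Rightarrow> complex" where
  "riemann_xi = remove_sings
     (\<lambda>s. 1 / 2 * s * (s - 1) * of_real pi powr (- s / 2) * Gamma (s / 2) * riemann_zeta s)"

definition xi_gamma :: "nat \<Rightarrow> complex" where
  "xi_gamma m = fact m / fact (2 * m) * (deriv ^^ (2 * m)) riemann_xi (1 / 2)"

definition hermite :: "nat \<Rightarrow> complex poly" where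
  "hermite = (THE H. \<forall>x t. (\<lambda>d. poly (H d) x * t ^ d / fact d) sums exp (2 * x * t - t\<^sup>2))"

lemma hermite_ex1:
  "\<exists>!H :: nat \<Rightarrow> complex poly.
     \<forall>x t. (\<lambda>d. poly (H d) x * t ^ d / fact d) sums exp (2 * x * t - t\<^sup>2)"
proof (rule ex_ex1I)
  define b :: "nat \<Rightarrow> complex" where
    "b n = (if even n then (-1) ^ (n div 2) / fact (n div 2) else 0)" for n
  define H :: "nat \<Rightarrow> complex poly" where
    "H d = smult (fact d) (\<Sum>i\<le>d. monom (2 ^ i / fact i * b (d - i)) i)" for d
  have "(\<lambda>d. poly (H d) x * t ^ d / fact d) sums exp (2 * x * t - t\<^sup>2)" for x t
  proof -
    define A where "A i = (2 * x * t) ^ i / fact i" for i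
    define B where "B n = b n * t ^ n" for n
    have A: "A sums exp (2 * x * t)"
      using exp_converges[of "2 * x * t"] by (simp add: A_def[abs_def] scaleR_conv_of_real field_simps)
    have nA: "summable (\<lambda>i. norm (A i))"
      using summable_norm_exp[of "2 * x * t"]
      by (simp add: A_def scaleR_conv_of_real field_simps norm_mult norm_divide norm_power)
    have ev: "B (2 * n) = (- (t\<^sup>2)) ^ n / fact n" for n
      by (simp add: B_def b_def power_mult power_minus[of "t\<^sup>2"])
    have B: "B sums exp (- (t\<^sup>2))"
    proof -
      have "(\<lambda>n. B (2 * n)) sums exp (- (t\<^sup>2))"
        using exp_converges[of "- (t\<^sup>2)"] unfolding ev by (simp add: scaleR_conv_of_real field_simps)
      then show ?thesis
        by (subst (asm) sums_mono_reindex) (auto simp: strict_mono_def B_def b_def elim!: evenE)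
    qed
    have nB: "summable (\<lambda>i. norm (B i))"
    proof -
      have "summable (\<lambda>n. norm (B (2 * n)))"
        using summable_norm_exp[of "- (t\<^sup>2)"]
        unfolding ev by (simp add: scaleR_conv_of_real field_simps norm_mult norm_divide norm_power)
      then show ?thesis
        by (subst (asm) summable_mono_reindex) (auto simp: strict_mono_def B_def b_def elim!: evenE)
    qed
    have "(\<lambda>k. \<Sum>i\<le>k. A i * B (k - i)) sums ((\<Sum>k. A k) * (\<Sum>k. B k))"
      by (rule Cauchy_product_sums[OF nA nB])
    also have "(\<Sum>k. A k) * (\<Sum>k. B k) = exp (2 * x * t - t\<^sup>2)"
      by (simp add: sums_unique[OF A, symmetric] sums_unique[OF B, symmetric] flip: exp_add)
    also have "(\<lambda>k. \<Sum>i\<le>k. A i * B (k - i)) = (\<lambda>d. poly (H d) x * t ^ d / fact d)"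
    proof
      fix k
      have "poly (H k) x * t ^ k / fact k = (\<Sum>i\<le>k. 2 ^ i / fact i * b (k - i) * x ^ i) * t ^ k"
        by (simp add: H_def poly_sum poly_monom)
      also have "\<dots> = (\<Sum>i\<le>k. A i * B (k - i))"
        unfolding sum_distrib_right
      proof (rule sum.cong)
        fix i assume "i \<in> {..k}"
        then have "t ^ k = t ^ i * t ^ (k - i)" by (simp flip: power_add)
        then show "2 ^ i / fact i * b (k - i) * x ^ i * t ^ k = A i * B (k - i)"
          by (simp add: A_def B_def power_mult_distrib)
      qed simp
      finally show "(\<Sum>i\<le>k. A i * B (k - i)) = poly (H k) x * t ^ k / fact k" ..
    qed
    finally show ?thesis .
  qed
  then show "\<exists>H :: nat \<Rightarrow> complex poly.
     \<forall>x t. (\<lambda>d. poly (H d) x * t ^ d / fact d) sums exp (2 * x * t - t\<^sup>2)" by blast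
next
  fix H K :: "nat \<Rightarrow> complex poly"
  assume H: "\<forall>x t. (\<lambda>d. poly (H d) x * t ^ d / fact d) sums exp (2 * x * t - t\<^sup>2)"
    and K: "\<forall>x t. (\<lambda>d. poly (K d) x * t ^ d / fact d) sums exp (2 * x * t - t\<^sup>2)"
  have "poly (H d) x = poly (K d) x" for d x
  proof -
    define c where "c d = (poly (H d) x - poly (K d) x) / fact d" for d
    have c: "(\<lambda>d. c d * (t - 0) ^ d) sums 0" for t
      using sums_diff[OF H[rule_format, of x t] K[rule_format, of x t]]
      by (simp add: c_def field_simps)
    have "c d = 0"
    proof (rule ccontr)
      assume nz: "c d \<noteq> 0"
      have "c 0 = 0"
        using c[of 0] by simp
      with nz have "d > 0" by (cases d) auto
      obtain e where "0 < e" "\<And>z. z \<in> cball (0 :: complex) e - {0} \<Longrightarrow> (0 :: complex) \<noteq> 0"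
        by (rule powser_0_nonzero[of 1 0 c "\<lambda>_. 0" d]) (use c nz \<open>d > 0\<close> in auto)
      from this(2)[of "of_real e"] \<open>0 < e\<close> show False by simp
    qed
    then show ?thesis by (simp add: c_def)
  qed
  then show "H = K" by (simp add: fun_eq_iff flip: poly_eq_poly_eq_iff)
qed

lemma hermite_generating_function:
  "(\<lambda>d. poly (hermite d) x * t ^ d / fact d) sums exp (2 * x * t - t\<^sup>2)"
  using theI'[OF hermite_ex1] unfolding hermite_def by blast

definition jensen_hermite :: "nat \<Rightarrow> nat \<Rightarrow> complex poly" where
  "jensen_hermite d n =
     (\<Sum>j\<le>d. smult (of_nat (d choose j) * xi_gamma (n + j)) (hermite (d - j)))"

definition hyperbolic :: "complex poly \<Rightarrow> bool" where
  "hyperbolic p \<longleftrightarrow> (\<forall>z. poly p z = 0 \<longrightarrow> z \<in> \<real>)"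

end

theory Submission
  imports Defs "HOL-Computational_Algebra.Fundamental_Theorem_Algebra" "HOL-Real_Asymp.Real_Asymp"
begin

text \<open>Turan's criterion: a real combination \<open>\<Sum>k\<le>d. a\<^sub>k H\<^sub>k\<close> of Hermite polynomials has only real zeros
  if \<open>\<Sum>k\<le>d-2. 2\<^sup>k k! a\<^sub>k\<^sup>2 < 2\<^sup>d (d-1)! a\<^sub>d\<^sup>2\<close>. With \<open>a\<^bsub>d-j\<^esub> = (d choose j) \<gamma>(n+j)\<close> this holds as soon as
  \<open>\<gamma>(n+j) \<le> r\<^sup>j \<gamma>(n)\<close> for some \<open>r \<le> d\<close> to the power \<open>-3/4\<close>, so it suffices that
  \<open>\<gamma>(m+1) / \<gamma>(m) \<le> log\<^sup>2 m / (2m)\<close> for large \<open>m\<close>. The theta transformation gives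
  \<open>\<xi>(1/2 + z) = 1/2 + (z\<^sup>2 - 1/4)/2 \<cdot> 4 \<integral> cosh (z u) d\<mu>(u)\<close> for a positive measure \<open>\<mu>\<close> on the half-line
  whose density decays like \<open>exp (- \<pi> exp (2u))\<close>; hence \<open>\<gamma>(m)\<close> is governed by the moments of \<open>\<mu>\<close>, and the
  part of a moment coming from \<open>u > log m\<close> is negligible.\<close>

section \<open>Turan's criterion for Hermite expansions\<close>

text \<open>The exponent 3/4 comes from the first term that Turan's criterion constrains. The two
  leading terms of the expansion merge into a linear factor times the Hermite polynomial of degree d
  - 1, so the coefficient with j = 1 is free. For j \<ge> 2 the ratio of the j-th term to the
  leading one is at most 2^(-j) d^(1+j) r^(2j), and j = 2 is the critical case: d^3 r^4 \<le> 1. The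
  constant 1/2 turns the hypothesis into r \<le> d^(-3/4) for r = log^2 n / (2n). The growth
  estimate has a factor of two to spare: the factorials contribute about 1/(4m) to the ratio of
  consecutive coefficients and the moments at most log^2 m + 1, so crude tail bounds suffice.
  Asymptotic information on the coefficients is enough, because for large d the hypothesis pushes n
  beyond any fixed threshold. Zeta is given only as a continuation of its Dirichlet series. All
  integrals are therefore taken at real s > 1, and complex arguments enter through a power series
  and the identity theorem.\<close>

lemma hermite_gf_fps:
  "(\<lambda>t. exp (2 * x * t - t\<^sup>2)) has_fps_expansion Abs_fps (\<lambda>d. poly (hermite d) x / fact d)"
  using hermite_generating_function[of x]
  by (intro has_fps_expansionI always_eventually allI) (simp add: field_simps)

text \<open>Both sides expand the t-derivative of exp(2xt - t^2), so uniqueness of expansions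
  identifies them. Comparing coefficients gives the three-term recurrence.\<close>

lemma hermite_gf_deriv:
  "fps_deriv (Abs_fps (\<lambda>d. poly (hermite d) x / fact d)) =
     (fps_const (2 * x) - fps_const 2 * fps_X) * Abs_fps (\<lambda>d. poly (hermite d) x / fact d)"
proof (rule fps_expansion_unique_complex)
  have "deriv (\<lambda>t. exp (2 * x * t - t\<^sup>2)) = (\<lambda>t. (2 * x - 2 * t) * exp (2 * x * t - t\<^sup>2))"
    by (intro ext DERIV_imp_deriv) (auto intro!: derivative_eq_intros)
  then show "(\<lambda>t. (2 * x - 2 * t) * exp (2 * x * t - t\<^sup>2)) has_fps_expansion
      fps_deriv (Abs_fps (\<lambda>d. poly (hermite d) x / fact d))"
    using has_fps_expansion_deriv[OF hermite_gf_fps[of x]] by simp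
  show "(\<lambda>t. (2 * x - 2 * t) * exp (2 * x * t - t\<^sup>2)) has_fps_expansion
      (fps_const (2 * x) - fps_const 2 * fps_X) * Abs_fps (\<lambda>d. poly (hermite d) x / fact d)"
    by (intro fps_expansion_intros hermite_gf_fps)
qed

lemma hermite_0: "hermite 0 = 1"
proof -
  have "poly (hermite 0) x = poly 1 x" for x
    using fps_nth_fps_expansion[OF hermite_gf_fps[of x], of 0] by simp
  then show ?thesis by (simp add: fun_eq_iff flip: poly_eq_poly_eq_iff)
qed

lemma hermite_1: "hermite (Suc 0) = [:0, 2:]"
proof -
  have "poly (hermite (Suc 0)) x = poly [:0, 2:] x" for x
    using arg_cong[OF hermite_gf_deriv[of x], of "\<lambda>F. fps_nth F 0"] by (simp add: hermite_0)
  then show ?thesis by (simp add: fun_eq_iff flip: poly_eq_poly_eq_iff)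
qed

lemma hermite_Suc_Suc:
  "hermite (Suc (Suc n)) = [:0, 2:] * hermite (Suc n) - smult (2 * of_nat (Suc n)) (hermite n)"
proof -
  have "poly (hermite (Suc (Suc n))) x =
      poly ([:0, 2:] * hermite (Suc n) - smult (2 * of_nat (Suc n)) (hermite n)) x" for x
  proof -
    have "of_nat (Suc (Suc n)) * (poly (hermite (Suc (Suc n))) x / fact (Suc (Suc n))) =
        2 * x * (poly (hermite (Suc n)) x / fact (Suc n)) - 2 * (poly (hermite n) x / fact n)"
      using arg_cong[OF hermite_gf_deriv[of x], of "\<lambda>F. fps_nth F (Suc n)"]
      by (simp add: algebra_simps del: fact_Suc of_nat_Suc flip: fps_X_mult_nth) 
         (simp add: fps_mult_left_const_nth algebra_simps)
    moreover have "fact (Suc (Suc n)) = (of_nat (Suc (Suc n)) * of_nat (Suc n) * fact n :: complex)"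
      "fact (Suc n) = (of_nat (Suc n) * fact n :: complex)" by simp_all
    moreover have "fact n \<noteq> (0::complex)" "of_nat (Suc n) \<noteq> (0::complex)" "of_nat (Suc (Suc n)) \<noteq> (0::complex)"
      by (simp_all del: of_nat_Suc)
    ultimately show ?thesis
      by (simp add: field_simps del: fact_Suc of_nat_Suc)
  qed
  then show ?thesis by (simp add: fun_eq_iff flip: poly_eq_poly_eq_iff)
qed

lemma pderiv_hermite: "pderiv (hermite (Suc n)) = smult (2 * of_nat (Suc n)) (hermite n)"
proof (induction n rule: induct_nat_012)
  case 0
  show ?case by (simp add: hermite_0 hermite_1 pderiv_pCons)
next
  case 1
  show ?case
    by (simp add: hermite_Suc_Suc[of 0] hermite_0 hermite_1 pderiv_pCons pderiv_diff pderiv_mult)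
next
  case (ge2 n)
  have "poly (pderiv (hermite (Suc (Suc (Suc n))))) x =
      poly (smult (2 * of_nat (Suc (Suc (Suc n)))) (hermite (Suc (Suc n)))) x" for x
    unfolding hermite_Suc_Suc[of "Suc n"] pderiv_diff pderiv_mult pderiv_smult ge2
    by (simp add: pderiv_pCons hermite_Suc_Suc[of n] algebra_simps)
  then show ?case by (simp add: fun_eq_iff flip: poly_eq_poly_eq_iff)
qed

lemma degree_lead_coeff_hermite: "degree (hermite n) = n \<and> coeff (hermite n) n = 2 ^ n"
proof (induction n rule: induct_nat_012)
  case (ge2 n)
  have "degree (hermite (Suc (Suc n))) \<le> Suc (Suc n)"
    unfolding hermite_Suc_Suc
    by (intro degree_diff_le order_trans[OF degree_mult_le] order_trans[OF degree_smult_le])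
       (use ge2 in auto)
  moreover have "coeff (hermite (Suc (Suc n))) (Suc (Suc n)) = 2 ^ Suc (Suc n)"
    unfolding hermite_Suc_Suc using ge2 by (simp add: coeff_eq_0)
  ultimately show ?case
    using le_degree[of "hermite (Suc (Suc n))" "Suc (Suc n)"] by auto
qed (simp_all add: hermite_0 hermite_1)

lemma degree_hermite: "degree (hermite n) = n"
  using degree_lead_coeff_hermite by blast

lemma hermite_nonzero: "hermite n \<noteq> 0"
  using degree_lead_coeff_hermite[of n] by auto

lemma hermite_Reals:
  assumes "x \<in> \<real>"
  shows "poly (hermite n) x \<in> \<real>"
  by (induction n rule: induct_nat_012)
     (use assms in \<open>auto simp: hermite_0 hermite_1 hermite_Suc_Suc intro!: Reals_diff Reals_mult Reals_add\<close>)

text \<open>A common zero would descend through the recurrence to \<open>hermite 0\<close>, which is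
  1. Since the derivative of \<open>hermite (Suc n)\<close> is a nonzero multiple of
  \<open>hermite n\<close>, this is what makes all zeros simple.\<close>

lemma hermite_no_common_root:
  "\<not> (poly (hermite (Suc n)) z = 0 \<and> poly (hermite n) z = 0)"
proof (induction n)
  case 0
  then show ?case by (simp add: hermite_0)
next
  case (Suc n)
  then show ?case by (auto simp: hermite_Suc_Suc[of n] simp del: of_nat_Suc)
qed

lemma rsquarefree_hermite: "rsquarefree (hermite n)"
proof (cases n)
  case 0
  then show ?thesis by (simp add: hermite_0 rsquarefree_roots)
next
  case (Suc m)
  then show ?thesis
    using hermite_no_common_root[of m]
    by (auto simp: rsquarefree_roots pderiv_hermite simp del: of_nat_Suc)
qed

lemma hermite_decompose:
  "hermite n = smult (2 ^ n) (\<Prod>x | poly (hermite n) x = 0. [:- x, 1:])"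
  using complex_poly_decompose_rsquarefree[OF rsquarefree_hermite[of n]] degree_lead_coeff_hermite[of n]
  by simp

lemma card_roots_hermite: "card {x. poly (hermite n) x = 0} = n"
proof -
  have "degree (hermite n) = card {x. poly (hermite n) x = 0}"
    by (subst hermite_decompose) (simp add: degree_prod_eq_sum_degree)
  then show ?thesis by (simp add: degree_hermite)
qed

section \<open>Real zeros from partial fractions, and the Christoffel-Darboux identity\<close>

text \<open>Division by \<open>q\<close> gives b + a z - \<Sum> t(x) / (z - x), with simple real
  poles and t(x) \<ge> 0. At a nonreal z its imaginary part is Im z times a + \<Sum> t(x) / |z -
  x|^2, which is positive, so it cannot vanish.\<close>

lemma real_root_of_pole_expansion:
  fixes q R :: "complex poly" and X :: "complex set" and a b :: real
  assumes X: "finite X" "X \<subseteq> \<real>"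
    and q: "q = smult c (\<Prod>x\<in>X. [:- x, 1:])" "c \<noteq> 0"
    and R: "degree R < card X"
    and res: "\<And>x. x \<in> X \<Longrightarrow> \<exists>t\<ge>0. poly R x = - of_real t * poly (pderiv q) x"
    and a: "a > 0"
    and z: "poly ([:of_real b, of_real a:] * q + R) z = 0"
  shows "z \<in> \<real>"
proof (rule ccontr)
  assume nz: "z \<notin> \<real>"
  obtain t where t: "\<And>x. x \<in> X \<Longrightarrow> t x \<ge> 0"
      "\<And>x. x \<in> X \<Longrightarrow> poly R x = - of_real (t x) * poly (pderiv q) x"
    using res by metis
  define Q where "Q x = smult c (\<Prod>y\<in>X - {x}. [:- y, 1:])" for x
  have qQ: "q = [:- x, 1:] * Q x" if "x \<in> X" for x
    unfolding q(1) Q_def by (subst prod.remove[OF X(1) that]) simp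
  have dq: "poly (pderiv q) x = poly (Q x) x" if "x \<in> X" for x
    unfolding qQ[OF that] pderiv_mult poly_add poly_mult by (simp add: pderiv_pCons)
  have Q0: "poly (Q x) y = 0" if "y \<in> X" "x \<noteq> y" for x y
    using that X(1) by (auto simp: Q_def poly_prod)
  \<comment> \<open>Lagrange interpolation: \<open>Q x\<close> vanishes on the rest of
    \<open>X\<close> and equals the derivative of \<open>q\<close> at \<open>x\<close>. Both sides
    agree on \<open>X\<close> and have degree below \<open>card X\<close>.\<close>
  have "R = (\<Sum>x\<in>X. smult (- of_real (t x)) (Q x))"
  proof (rule poly_eqI_degree[where A = X])
    fix y assume y: "y \<in> X"
    have "poly (\<Sum>x\<in>X. smult (- of_real (t x)) (Q x)) y
        = (\<Sum>x\<in>X. if x = y then - of_real (t y) * poly (Q y) y else 0)"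
      unfolding poly_sum by (intro sum.cong) (auto simp: Q0 y)
    also have "\<dots> = poly R y"
      using X(1) y by (simp add: t(2) dq)
    finally show "poly R y = poly (\<Sum>x\<in>X. smult (- of_real (t x)) (Q x)) y" ..
  next
    have "degree (\<Sum>x\<in>X. smult (- of_real (t x)) (Q x)) \<le> card X - 1"
    proof (rule degree_sum_le[OF X(1)])
      fix x assume x: "x \<in> X"
      have "degree (smult (- of_real (t x)) (Q x)) \<le> degree (\<Prod>y\<in>X - {x}. [:- y, 1:])"
        unfolding Q_def by (intro order_trans[OF degree_smult_le] order_refl)
      also have "\<dots> = card X - 1"
        using x X(1) by (simp add: degree_prod_eq_sum_degree)
      finally show "degree (smult (- of_real (t x)) (Q x)) \<le> card X - 1" .
    qed
    then show "degree (\<Sum>x\<in>X. smult (- of_real (t x)) (Q x)) < card X"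
      using R by linarith
  qed (fact R)
  then have "poly R z = (\<Sum>x\<in>X. - of_real (t x) * poly (Q x) z)"
    by (simp add: poly_sum)
  also have "\<dots> = (\<Sum>x\<in>X. - (poly q z * (of_real (t x) / (z - x))))"
  proof (rule sum.cong[OF refl])
    fix x assume x: "x \<in> X"
    then have "z - x \<noteq> 0" using nz X(2) by auto
    moreover have "poly q z = (z - x) * poly (Q x) z"
      unfolding qQ[OF x] poly_mult by simp
    ultimately show "- of_real (t x) * poly (Q x) z = - (poly q z * (of_real (t x) / (z - x)))"
      by simp
  qed
  finally have "poly q z * (of_real b + of_real a * z - (\<Sum>x\<in>X. of_real (t x) / (z - x))) = 0"
    using z by (simp add: sum_negf sum_distrib_left algebra_simps)
  moreover have "poly q z \<noteq> 0"
    using nz X q by (auto simp: poly_prod)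
  ultimately have "Im (of_real b + of_real a * z - (\<Sum>x\<in>X. of_real (t x) / (z - x))) = 0"
    by simp
  moreover have "Im (of_real (t x) / (z - x)) = - Im z * (t x / (cmod (z - x))\<^sup>2)" if "x \<in> X" for x
    using that X(2) by (auto simp: Im_divide cmod_power2 elim!: Reals_cases)
  ultimately have "Im z * (a + (\<Sum>x\<in>X. t x / (cmod (z - x))\<^sup>2)) = 0"
    by (simp add: sum_distrib_left sum_negf algebra_simps)
  moreover have "Im z \<noteq> 0"
    using nz by (simp add: complex_is_Real_iff)
  moreover have "(\<Sum>x\<in>X. t x / (cmod (z - x))\<^sup>2) \<ge> 0"
    using t(1) by (intro sum_nonneg) auto
  ultimately show False using a by auto
qed

text \<open>The confluent form of the identity; the induction step only needs the recurrence and its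
  derivative.\<close>

lemma hermite_christoffel_darboux:
  "(\<Sum>k\<le>n. (poly (hermite k) x)\<^sup>2 / (2 ^ k * fact k)) =
     (poly (pderiv (hermite (Suc n))) x * poly (hermite n) x -
      poly (pderiv (hermite n)) x * poly (hermite (Suc n)) x) / (2 ^ Suc n * fact n)"
proof (induction n)
  case 0
  then show ?case by (simp add: hermite_0 hermite_1 pderiv_pCons)
next
  case (Suc n)
  define A B A' B' where "A = poly (hermite n) x" "B = poly (hermite (Suc n)) x"
    "A' = poly (pderiv (hermite n)) x" "B' = poly (pderiv (hermite (Suc n))) x"
  define N :: complex where "N = of_nat (Suc n)"
  have C: "poly (hermite (Suc (Suc n))) x = 2 * x * B - 2 * N * A"
    "poly (pderiv (hermite (Suc (Suc n)))) x = 2 * B + 2 * x * B' - 2 * N * A'"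
    unfolding hermite_Suc_Suc
    by (simp_all add: A_B_A'_B'_def N_def pderiv_diff pderiv_mult pderiv_smult pderiv_pCons algebra_simps)
  have N: "N \<noteq> 0" "fact (Suc n) = N * fact n" by (simp_all add: N_def del: of_nat_Suc)
  have "(\<Sum>k\<le>Suc n. (poly (hermite k) x)\<^sup>2 / (2 ^ k * fact k)) =
     (B' * A - A' * B) / (2 ^ Suc n * fact n) + B\<^sup>2 / (2 ^ Suc n * (N * fact n))"
    unfolding sum.atMost_Suc Suc.IH N(2) by (simp add: A_B_A'_B'_def)
  also have "\<dots> = (2 * N * (B' * A - A' * B) + 2 * B\<^sup>2) / (2 ^ Suc (Suc n) * (N * fact n))"
    using N(1) by (simp add: field_simps)
  also have "2 * N * (B' * A - A' * B) + 2 * B\<^sup>2 =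
      (2 * B + 2 * x * B' - 2 * N * A') * B - B' * (2 * x * B - 2 * N * A)"
    by (simp add: algebra_simps power2_eq_square)
  finally show ?case unfolding C N(2) by (simp only: A_B_A'_B'_def)
qed

text \<open>At a zero of \<open>hermite (Suc m)\<close> one of the two products drops out. The
  normalising factor is the one in Turan's inequality for degree m + 2, and the right-hand side is
  then the square of the derivative of \<open>hermite (Suc m)\<close> at \<open>x\<close>.\<close>

lemma hermite_kernel_at_root:
  assumes "poly (hermite (Suc m)) x = 0"
  shows "(\<Sum>k\<le>m. (poly (hermite k) x)\<^sup>2 / (2 ^ k * fact k)) * (2 ^ (m + 2) * fact (m + 1)) =
     (2 * of_nat (Suc m) * poly (hermite m) x)\<^sup>2"
proof -
  have f: "fact (m + 1) = of_nat (Suc m) * (fact m :: complex)" by simp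
  show ?thesis
    unfolding hermite_christoffel_darboux pderiv_hermite f using assms
    by (simp add: field_simps power2_eq_square del: of_nat_Suc)
qed

text \<open>Cauchy--Schwarz and the Christoffel--Darboux formula at the zeros of the Hermite polynomial
  of degree \<open>m + 1\<close> show that dividing the sum by this polynomial gives residues of constant sign.\<close>

lemma turan_hermite_aux:
  fixes a :: "nat \<Rightarrow> real"
  assumes real: "{x. poly (hermite (Suc m)) x = 0} \<subseteq> \<real>"
    and pos: "a (m + 2) > 0"
    and less: "(\<Sum>k\<le>m. 2 ^ k * fact k * (a k)\<^sup>2) < 2 ^ (m + 2) * fact (m + 1) * (a (m + 2))\<^sup>2"
    and z: "poly (\<Sum>k\<le>m + 2. smult (of_real (a k)) (hermite k)) z = 0"
  shows "z \<in> \<real>"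
proof -
  define X where "X = {x. poly (hermite (Suc m)) x = 0}"
  define S where "S = (\<Sum>k\<le>m. smult (of_real (a k)) (hermite k))"
  define R where "R = S - smult (of_real (2 * real (Suc m) * a (m + 2))) (hermite m)"
  \<comment> \<open>The recurrence splits \<open>hermite (m + 2)\<close>: its first part joins the
    term of index m + 1 to form the linear factor, its second part goes into \<open>R\<close>. Hence
    no condition on \<open>a (m + 1)\<close> arises.\<close>
  have eq: "(\<Sum>k\<le>m + 2. smult (of_real (a k)) (hermite k)) =
      [:of_real (a (m + 1)), of_real (2 * a (m + 2)):] * hermite (Suc m) + R"
    by (intro poly_eq_poly_eq_iff[THEN iffD1] ext)
       (simp add: R_def S_def hermite_Suc_Suc[of m] algebra_simps)
  show ?thesis
  proof (rule real_root_of_pole_expansion)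
    show "finite X" unfolding X_def by (intro poly_roots_finite hermite_nonzero)
    show "X \<subseteq> \<real>" using real by (simp add: X_def)
    show "hermite (Suc m) = smult (2 ^ Suc m) (\<Prod>x\<in>X. [:- x, 1:])"
      unfolding X_def by (rule hermite_decompose)
    show "poly ([:of_real (a (m + 1)), of_real (2 * a (m + 2)):] * hermite (Suc m) + R) z = 0"
      using z unfolding eq .
    have "degree S \<le> m"
      unfolding S_def
      by (intro degree_sum_le order_trans[OF degree_smult_le]) (auto simp: degree_hermite)
    then have "degree R \<le> m"
      unfolding R_def
      by (intro degree_diff_le order_trans[OF degree_smult_le]) (auto simp: degree_hermite)
    then show "degree R < card X"
      unfolding X_def card_roots_hermite by simp
    fix x assume x: "x \<in> X"
    define h where "h k = Re (poly (hermite k) x)" for k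
    have h: "poly (hermite k) x = of_real (h k)" for k
      using hermite_Reals[of x k] x real by (auto simp: h_def X_def)
    define s where "s = (\<Sum>k\<le>m. a k * h k)"
    have Sx: "poly S x = of_real s"
      by (simp add: S_def s_def poly_sum h)
    \<comment> \<open>\<open>y\<close> is the derivative of \<open>hermite (Suc m)\<close> at
      \<open>x\<close>, so the required t is \<open>a (m + 2) - s / y\<close>, and it remains to
      bound \<open>s / y\<close>.\<close>
    define y where "y = 2 * real (Suc m) * h m"
    have "h m \<noteq> 0"
      using hermite_no_common_root[of m x] x by (auto simp: X_def h)
    then have y: "y \<noteq> 0" by (simp add: y_def)
    have "complex_of_real ((\<Sum>k\<le>m. (h k)\<^sup>2 / (2 ^ k * fact k)) * (2 ^ (m + 2) * fact (m + 1))) =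
        of_real (y\<^sup>2)"
      using hermite_kernel_at_root[of m x] x by (simp add: X_def h y_def)
    then have ker: "(\<Sum>k\<le>m. (h k)\<^sup>2 / (2 ^ k * fact k)) * (2 ^ (m + 2) * fact (m + 1)) = y\<^sup>2"
      unfolding of_real_eq_iff .
    \<comment> \<open>The weights 2^k k! are the squared norms of the Hermite polynomials up to a
      common factor. They split the Cauchy-Schwarz bound into the hypothesis on \<open>a\<close> and
      the kernel at the zero.\<close>
    have "s\<^sup>2 = (\<Sum>k\<le>m. (sqrt (2 ^ k * fact k) * a k) * (h k / sqrt (2 ^ k * fact k)))\<^sup>2"
      by (simp add: s_def)
    also have "\<dots> \<le> (\<Sum>k\<le>m. (sqrt (2 ^ k * fact k) * a k)\<^sup>2) * (\<Sum>k\<le>m. (h k / sqrt (2 ^ k * fact k))\<^sup>2)"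
      by (rule Cauchy_Schwarz_ineq_sum)
    also have "\<dots> = (\<Sum>k\<le>m. 2 ^ k * fact k * (a k)\<^sup>2) * (\<Sum>k\<le>m. (h k)\<^sup>2 / (2 ^ k * fact k))"
      by (simp add: power_mult_distrib power_divide)
    also have "\<dots> \<le> (2 ^ (m + 2) * fact (m + 1) * (a (m + 2))\<^sup>2) * (\<Sum>k\<le>m. (h k)\<^sup>2 / (2 ^ k * fact k))"
      using less by (intro mult_right_mono sum_nonneg) auto
    also have "\<dots> = (a (m + 2) * y)\<^sup>2"
      by (simp add: power_mult_distrib flip: ker)
    finally have "\<bar>s\<bar> \<le> \<bar>a (m + 2) * y\<bar>"
      by (simp add: abs_le_square_iff)
    then have "\<bar>s / y\<bar> \<le> a (m + 2)"
      using y pos by (simp add: abs_mult abs_divide divide_le_eq)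
    then have "s / y \<le> a (m + 2)" by linarith
    moreover have "poly R x = - of_real (a (m + 2) - s / y) * poly (pderiv (hermite (Suc m))) x"
    proof -
      have "poly (pderiv (hermite (Suc m))) x = of_real y"
        by (simp add: pderiv_hermite h y_def)
      moreover have "poly R x = of_real (s - a (m + 2) * y)"
        by (simp add: R_def Sx h y_def)
      moreover have "s - a (m + 2) * y = - (a (m + 2) - s / y) * y"
        using y by (simp add: field_simps)
      ultimately show ?thesis by (simp only: of_real_mult of_real_minus)
    qed
    ultimately show "\<exists>t\<ge>0. poly R x = - of_real t * poly (pderiv (hermite (Suc m))) x"
      by (intro exI[of _ "a (m + 2) - s / y"]) auto
  qed (use pos in auto)
qed

text \<open>The preceding lemma assumes real zeros one degree below. Applied to the expansion with
  the single coefficient a(n+2) = 1, where the left side of Turan's inequality is 0, it carries the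
  induction and so discharges its own assumption.\<close>

lemma hermite_roots_real: "{x. poly (hermite n) x = 0} \<subseteq> \<real>"
proof (induction n rule: induct_nat_012)
  case (ge2 n)
  show ?case
  proof
    fix z assume z: "z \<in> {x. poly (hermite (Suc (Suc n))) x = 0}"
    define a where "a k = (if k = n + 2 then 1 else 0 :: real)" for k
    have "(\<Sum>k\<le>n + 2. smult (of_real (a k)) (hermite k)) = hermite (Suc (Suc n))"
      by (simp add: a_def)
    moreover have "(\<Sum>k\<le>n. 2 ^ k * fact k * (a k)\<^sup>2) = 0"
      by (intro sum.neutral) (auto simp: a_def)
    ultimately show "z \<in> \<real>"
      using z by (intro turan_hermite_aux[OF ge2(2), of a]) (auto simp: a_def)
  qed
qed (auto simp: hermite_0 hermite_1)

theorem turan_hermite: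
  fixes a :: "nat \<Rightarrow> real"
  assumes "a (m + 2) > 0"
    and "(\<Sum>k\<le>m. 2 ^ k * fact k * (a k)\<^sup>2) < 2 ^ (m + 2) * fact (m + 1) * (a (m + 2))\<^sup>2"
  shows "hyperbolic (\<Sum>k\<le>m + 2. smult (of_real (a k)) (hermite k))"
  using turan_hermite_aux[OF hermite_roots_real assms] by (auto simp: hyperbolic_def)

section \<open>The theta transformation\<close>

lemma sum_cis_roots_of_unity:
  fixes j :: int and l :: nat
  assumes l: "l > 0"
  shows "(\<Sum>v<l. cis (2 * pi * of_int j / real l * real v)) = (if int l dvd j then of_nat l else 0)"
proof -
  define w where "w = cis (2 * pi * of_int j / real l)"
  have pw: "cis (2 * pi * of_int j / real l * real v) = w ^ v" for v
    unfolding w_def Complex.DeMoivre by (simp add: mult_ac)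
  have w1: "w = 1 \<longleftrightarrow> int l dvd j"
  proof
    assume "w = 1"
    then have "cos (2 * pi * of_int j / real l) = 1" by (simp add: w_def complex_eq_iff)
    then obtain n :: int where "2 * pi * of_int j / real l = of_int n * 2 * pi"
      by (auto simp: cos_one_2pi_int)
    then have "real_of_int j = real_of_int (n * int l)"
      using l by (simp add: field_simps)
    then show "int l dvd j" unfolding of_int_eq_iff by simp
  next
    assume "int l dvd j"
    then obtain n where "j = int l * n" by auto
    then have "2 * pi * of_int j / real l = 2 * pi * of_int n"
      using l by simp
    then show "w = 1" unfolding w_def by (simp only: cis_multiple_2pi Ints_of_int)
  qed
  have "w ^ l = cis (2 * pi * of_int j)"
    using pw[of l] l by simp
  then have "w ^ l = 1" by simp
  then show ?thesis
    unfolding pw by (auto simp: sum_gp_strict w1)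
qed

text \<open>Writing 2 cos as a sum of two conjugate exponentials and expanding binomially leaves the
  frequencies k - m; summation over \<open>v\<close> keeps those divisible by
  \<open>l\<close>.\<close>

lemma sum_cos_power_eq:
  assumes l: "l > 0"
  shows "(\<Sum>v<l. (2 * cos (pi * real v / real l)) ^ (2 * m)) =
     real l * (\<Sum>k\<le>2 * m. if int l dvd int k - int m then real ((2 * m) choose k) else 0)"
proof -
  have "complex_of_real ((2 * cos (pi * real v / real l)) ^ (2 * m)) =
      (\<Sum>k\<le>2 * m. of_nat ((2 * m) choose k) * cis (2 * pi * of_int (int k - int m) / real l * real v))" for v
  proof -
    define \<theta> where "\<theta> = pi * real v / real l"
    have "complex_of_real (2 * cos \<theta>) = cis \<theta> + cis (- \<theta>)"
      by (simp add: complex_eq_iff)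
    then have "complex_of_real ((2 * cos \<theta>) ^ (2 * m)) = (cis \<theta> + cis (- \<theta>)) ^ (2 * m)"
      by (simp only: of_real_power)
    also have "\<dots> = (\<Sum>k\<le>2 * m. of_nat ((2 * m) choose k) * cis \<theta> ^ k * cis (- \<theta>) ^ (2 * m - k))"
      by (rule binomial_ring)
    also have "\<dots> = (\<Sum>k\<le>2 * m. of_nat ((2 * m) choose k) * cis (2 * pi * of_int (int k - int m) / real l * real v))"
    proof (rule sum.cong[OF refl])
      fix k assume "k \<in> {..2 * m}"
      then have "real (2 * m - k) = 2 * real m - real k" by (simp add: of_nat_diff)
      then have "cis \<theta> ^ k * cis (- \<theta>) ^ (2 * m - k) = cis (real k * \<theta> + (2 * real m - real k) * (- \<theta>))"
        unfolding Complex.DeMoivre cis_mult by simp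
      also have "real k * \<theta> + (2 * real m - real k) * (- \<theta>) = 2 * pi * of_int (int k - int m) / real l * real v"
        unfolding \<theta>_def using l by (simp add: field_simps)
      finally show "of_nat ((2 * m) choose k) * cis \<theta> ^ k * cis (- \<theta>) ^ (2 * m - k) =
          of_nat ((2 * m) choose k) * cis (2 * pi * of_int (int k - int m) / real l * real v)"
        by (simp add: mult.assoc)
    qed
    finally show ?thesis by (simp add: \<theta>_def)
  qed
  then have "complex_of_real (\<Sum>v<l. (2 * cos (pi * real v / real l)) ^ (2 * m)) =
      (\<Sum>v<l. \<Sum>k\<le>2 * m. of_nat ((2 * m) choose k) * cis (2 * pi * of_int (int k - int m) / real l * real v))"
    by (simp only: of_real_sum)
  also have "\<dots> = (\<Sum>k\<le>2 * m. of_nat ((2 * m) choose k) *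
      (\<Sum>v<l. cis (2 * pi * of_int (int k - int m) / real l * real v)))"
    by (subst sum.swap) (simp only: sum_distrib_left)
  also have "\<dots> = of_real (real l * (\<Sum>k\<le>2 * m. if int l dvd int k - int m then real ((2 * m) choose k) else 0))"
    unfolding sum_cis_roots_of_unity[OF l] of_real_mult of_real_sum sum_distrib_left
    by (intro sum.cong) auto
  finally show ?thesis unfolding of_real_eq_iff .
qed

lemma sum_symmetric_middle:
  fixes f :: "nat \<Rightarrow> real"
  assumes "\<And>a. a \<le> m \<Longrightarrow> f (m - a) = f (m + a)"
  shows "(\<Sum>k\<le>2 * m. f k) = f m + 2 * (\<Sum>a=1..m. f (m + a))"
proof -
  have "{..2 * m} = {..<m} \<union> {m} \<union> {m+1..2 * m}" by auto
  then have "(\<Sum>k\<le>2 * m. f k) = (\<Sum>k<m. f k) + f m + (\<Sum>k=m+1..2 * m. f k)"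
    by (simp only:) (subst sum.union_disjoint; auto)+
  also have "(\<Sum>k<m. f k) = (\<Sum>a=1..m. f (m + a))"
  proof (rule sum.reindex_bij_witness[of _ "\<lambda>a. m - a" "\<lambda>k. m - k"])
    fix k assume "k \<in> {..<m}"
    then show "f (m + (m - k)) = f k" using assms[of "m - k"] by simp
  qed auto
  also have "(\<Sum>k=m+1..2 * m. f k) = (\<Sum>a=1..m. f (m + a))"
    by (rule sum.reindex_bij_witness[of _ "\<lambda>a. m + a" "\<lambda>k. k - m"]) auto
  finally show ?thesis by simp
qed

lemma sum_odd_symmetric:
  fixes f :: "nat \<Rightarrow> real"
  assumes "\<And>v. 1 \<le> v \<Longrightarrow> v \<le> q \<Longrightarrow> f (2 * q + 1 - v) = f v"
  shows "(\<Sum>v<2 * q + 1. f v) = f 0 + 2 * (\<Sum>v=1..q. f v)"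
proof -
  have "{..<2 * q + 1} = {0} \<union> {1..q} \<union> {q+1..2 * q}" by auto
  then have "(\<Sum>v<2 * q + 1. f v) = f 0 + (\<Sum>v=1..q. f v) + (\<Sum>v=q+1..2 * q. f v)"
    by (simp only:) (subst sum.union_disjoint; auto)+
  also have "(\<Sum>v=q+1..2 * q. f v) = (\<Sum>v=1..q. f v)"
    by (rule sum.reindex_bij_witness[of _ "\<lambda>v. 2 * q + 1 - v" "\<lambda>v. 2 * q + 1 - v"])
       (auto simp: assms[symmetric] Suc_diff_le)
  finally show ?thesis by simp
qed

text \<open>Polya's finite form of the theta transformation, which is the limit \<open>l \<rightarrow> \<infinity>\<close> with
  \<open>m / l\<^sup>2\<close> converging.\<close>

lemma finite_theta:
  fixes m q :: nat
  defines "l \<equiv> 2 * q + 1"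
  shows "1 + 2 * (\<Sum>v=1..q. cos (pi * real v / real l) ^ (2 * m)) =
     real l / 4 ^ m * (real ((2 * m) choose m) + 2 * (\<Sum>j=1..m. real ((2 * m) choose (m + j * l))))"
proof -
  have l: "l > 0" by (simp add: l_def)
  have "(\<Sum>v<l. (2 * cos (pi * real v / real l)) ^ (2 * m)) =
      4 ^ m + 2 * (\<Sum>v=1..q. (2 * cos (pi * real v / real l)) ^ (2 * m))"
  proof -
    \<comment> \<open>The reflection changes the sign of the cosine, which the even exponent hides.
      As \<open>l\<close> is odd, every \<open>v\<close> except 0 has a partner different from
      itself.\<close>
    have "cos (pi * real (l - v) / real l) = - cos (pi * real v / real l)" if "v \<le> q" for v
    proof -
      have "pi * real (l - v) / real l = pi - pi * real v / real l"
        using that l by (simp add: of_nat_diff l_def field_simps)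
      then show ?thesis by (simp add: cos_diff)
    qed
    then show ?thesis
      using sum_odd_symmetric[of q "\<lambda>v. (2 * cos (pi * real v / real l)) ^ (2 * m)"]
      by (simp add: power_mult flip: l_def)
         (simp add: l_def)
  qed
  also have "\<dots> = 4 ^ m * (1 + 2 * (\<Sum>v=1..q. cos (pi * real v / real l) ^ (2 * m)))"
  proof -
    have "(2::real) ^ (2 * m) = 4 ^ m" by (simp add: power_mult)
    then show ?thesis
      unfolding power_mult_distrib by (simp only: sum_distrib_left[symmetric] distrib_left)
  qed
  finally have "4 ^ m * (1 + 2 * (\<Sum>v=1..q. cos (pi * real v / real l) ^ (2 * m))) =
      real l * (\<Sum>k\<le>2 * m. if int l dvd int k - int m then real ((2 * m) choose k) else 0)"
    unfolding sum_cos_power_eq[OF l] ..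
  also have "(\<Sum>k\<le>2 * m. if int l dvd int k - int m then real ((2 * m) choose k) else 0) =
      real ((2 * m) choose m) + 2 * (\<Sum>a=1..m. if l dvd a then real ((2 * m) choose (m + a)) else 0)"
  proof (subst sum_symmetric_middle)
    fix a assume a: "a \<le> m"
    have "(2 * m) choose (m - a) = (2 * m) choose (m + a)"
      using binomial_symmetric[of "m - a" "2 * m"] a by (simp add: mult_2)
    then show "(if int l dvd int (m - a) - int m then real ((2 * m) choose (m - a)) else 0) =
        (if int l dvd int (m + a) - int m then real ((2 * m) choose (m + a)) else 0)"
      using a by (simp add: of_nat_diff)
  qed simp
  also have "(\<Sum>a=1..m. if l dvd a then real ((2 * m) choose (m + a)) else 0) =
      (\<Sum>a\<in>{a\<in>{1..m}. l dvd a}. real ((2 * m) choose (m + a)))"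
    by (rule sum.inter_filter[symmetric]) simp
  also have "\<dots> = (\<Sum>j\<in>{j\<in>{1..m}. j * l \<le> m}. real ((2 * m) choose (m + j * l)))"
    by (rule sum.reindex_bij_witness[of _ "\<lambda>j. j * l" "\<lambda>a. a div l"])
       (use l in \<open>auto simp: Suc_le_eq div_greater_zero_iff dvd_imp_le intro: order_trans[OF div_le_dividend]\<close>)
  \<comment> \<open>The added indices have \<open>j * l > m\<close>, where the binomial coefficient
    is zero.\<close>
  also have "\<dots> = (\<Sum>j=1..m. real ((2 * m) choose (m + j * l)))"
    by (rule sum.mono_neutral_left) auto
  finally show ?thesis by (simp add: field_simps)
qed


section \<open>Gaussian bounds for cosines and central binomial coefficients\<close>

text \<open>The function cos x * exp(x^2 / 2) is decreasing on [0, \<pi>], because x cos x \<le> sin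
  x there. The bound supplies the dominating series on the cosine side of the theta limit.\<close>

lemma cos_le_exp_neg_square:
  fixes x :: real
  assumes x: "0 \<le> x" "x \<le> pi"
  shows "cos x \<le> exp (- (x\<^sup>2 / 2))"
proof -
  have k: "y * cos y \<le> sin y" if "0 \<le> y" "y \<le> pi" for y
  proof -
    have "sin 0 - 0 * cos 0 \<le> sin y - y * cos y"
    proof (rule DERIV_nonneg_imp_nondecreasing[OF that(1)])
      fix t assume t: "0 \<le> t" "t \<le> y"
      have "((\<lambda>t. sin t - t * cos t) has_real_derivative t * sin t) (at t)"
        by (auto intro!: derivative_eq_intros)
      moreover have "t * sin t \<ge> 0"
        using t that by (intro mult_nonneg_nonneg sin_ge_zero) auto
      ultimately show "\<exists>d. ((\<lambda>t. sin t - t * cos t) has_real_derivative d) (at t) \<and> 0 \<le> d" by blast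
    qed
    then show ?thesis by simp
  qed
  have "cos x * exp (x\<^sup>2 / 2) \<le> cos 0 * exp (0\<^sup>2 / 2)"
  proof (rule DERIV_nonpos_imp_nonincreasing[OF x(1)])
    fix t assume t: "0 \<le> t" "t \<le> x"
    have "((\<lambda>t. cos t * exp (t\<^sup>2 / 2)) has_real_derivative (t * cos t - sin t) * exp (t\<^sup>2 / 2)) (at t)"
      by (auto intro!: derivative_eq_intros simp: algebra_simps)
    moreover have "(t * cos t - sin t) * exp (t\<^sup>2 / 2) \<le> 0"
      using k[of t] t x by (intro mult_nonpos_nonneg) auto
    ultimately show "\<exists>d. ((\<lambda>t. cos t * exp (t\<^sup>2 / 2)) has_real_derivative d) (at t) \<and> d \<le> 0" by blast
  qed
  then show ?thesis by (simp add: exp_minus field_simps)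
qed

lemma central_binomial_shift_Suc:
  "real (m + Suc i) * real ((2 * m) choose (m + Suc i)) = (real m - real i) * real ((2 * m) choose (m + i))"
proof (cases "i \<le> m")
  case True
  have "Suc (m + i) * ((2 * m) choose Suc (m + i)) = (m - i) * ((2 * m) choose (m + i))"
    using binomial_absorption[of "m + i" "2 * m"] binomial_absorb_comp[of "2 * m" "m + i"]
    by (simp add: mult_2)
  then have "real (Suc (m + i) * ((2 * m) choose Suc (m + i))) = real ((m - i) * ((2 * m) choose (m + i)))"
    by (simp only:)
  then show ?thesis using True by (simp add: of_nat_diff algebra_simps)
qed (simp add: binomial_eq_0)

text \<open>The step from i to i + 1 multiplies by 1 - (2i+1)/(m+i+1). Estimating this by an
  exponential and enlarging the denominator to the fixed m + a makes the odd numbers 2i + 1 add up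
  to a square.\<close>

lemma central_binomial_ratio_upper:
  assumes "i \<le> a" "a \<le> m" "m > 0"
  shows "real ((2 * m) choose (m + i)) / real ((2 * m) choose m) \<le> exp (- ((real i)\<^sup>2 / (real m + real a)))"
  using assms(1)
proof (induction i)
  case 0
  then show ?case by simp
next
  case (Suc i)
  have i: "i < m" using Suc.prems assms by simp
  have "real ((2 * m) choose (m + Suc i)) = (real m - real i) / (real m + real i + 1) * real ((2 * m) choose (m + i))"
    using central_binomial_shift_Suc[of m i] by (simp add: field_simps)
  then have "real ((2 * m) choose (m + Suc i)) / real ((2 * m) choose m) =
      (real m - real i) / (real m + real i + 1) * (real ((2 * m) choose (m + i)) / real ((2 * m) choose m))"
    by simp
  also have "\<dots> \<le> exp (- ((2 * real i + 1) / (real m + real a))) * exp (- ((real i)\<^sup>2 / (real m + real a)))"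
  proof (intro mult_mono)
    have "(real m - real i) / (real m + real i + 1) = 1 + - ((2 * real i + 1) / (real m + real i + 1))"
      by (simp add: field_simps)
    also have "\<dots> \<le> exp (- ((2 * real i + 1) / (real m + real i + 1)))"
      by (rule exp_ge_add_one_self)
    also have "\<dots> \<le> exp (- ((2 * real i + 1) / (real m + real a)))"
      using Suc.prems by (simp add: frac_le)
    finally show "(real m - real i) / (real m + real i + 1) \<le> exp (- ((2 * real i + 1) / (real m + real a)))" .
  qed (use Suc in auto)
  also have "\<dots> = exp (- ((real (Suc i))\<^sup>2 / (real m + real a)))"
    unfolding exp_add[symmetric] using assms
    by (simp add: power2_eq_square add_divide_distrib algebra_simps)
  finally show ?case .
qed

text \<open>Here the same factor is written as 1/(1 + (2i+1)/(m-i)). Since i < a in each step, m - i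
  is at least m - a + 1, which is where the extra 1 comes from.\<close>

lemma central_binomial_ratio_lower:
  assumes "i \<le> a" "a \<le> m"
  shows "exp (- ((real i)\<^sup>2 / (real m - real a + 1))) \<le> real ((2 * m) choose (m + i)) / real ((2 * m) choose m)"
  using assms(1)
proof (induction i)
  case 0
  then show ?case by simp
next
  case (Suc i)
  have i: "i < m" using Suc.prems assms by simp
  have "exp (- ((real (Suc i))\<^sup>2 / (real m - real a + 1))) =
      exp (- ((2 * real i + 1) / (real m - real a + 1))) * exp (- ((real i)\<^sup>2 / (real m - real a + 1)))"
    unfolding exp_add[symmetric]
    by (simp add: power2_eq_square add_divide_distrib algebra_simps)
  also have "\<dots> \<le> (real m - real i) / (real m + real i + 1) * (real ((2 * m) choose (m + i)) / real ((2 * m) choose m))"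
  proof (intro mult_mono)
    have "exp (- ((2 * real i + 1) / (real m - real a + 1))) \<le> exp (- ((2 * real i + 1) / (real m - real i)))"
      using Suc.prems i assms(2) by (auto intro!: divide_left_mono mult_pos_pos)
    also have "\<dots> = 1 / exp ((2 * real i + 1) / (real m - real i))"
      by (simp add: exp_minus field_simps)
    also have "\<dots> \<le> 1 / (1 + (2 * real i + 1) / (real m - real i))"
      using i by (intro divide_left_mono exp_ge_add_one_self mult_pos_pos add_pos_nonneg) auto
    also have "\<dots> = (real m - real i) / (real m + real i + 1)"
      using i by (simp add: field_simps)
    finally show "exp (- ((2 * real i + 1) / (real m - real a + 1))) \<le> (real m - real i) / (real m + real i + 1)" .
  qed (use Suc i in auto)
  also have "\<dots> = real ((2 * m) choose (m + Suc i)) / real ((2 * m) choose m)"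
  proof -
    have "real ((2 * m) choose (m + Suc i)) = (real m - real i) / (real m + real i + 1) * real ((2 * m) choose (m + i))"
      using central_binomial_shift_Suc[of m i] by (simp add: field_simps)
    then show ?thesis by simp
  qed
  finally show ?case .
qed

lemma central_binomial_tendsto:
  "(\<lambda>n. sqrt (real n) * real ((2 * n) choose n) / 4 ^ n) \<longlonglongrightarrow> 1 / sqrt pi"
proof -
  define W where "W n = (\<Prod>k=1..n. (4 * real k ^ 2) / (4 * real k ^ 2 - 1))" for n
  define c where "c n = real ((2 * n) choose n) / 4 ^ n" for n
  have cS: "c (Suc n) = c n * ((2 * real n + 1) / (2 * real n + 2))" for n
  proof -
    have "Suc n * ((2 * Suc n) choose Suc n) = 2 * Suc n * ((2 * n + 1) choose n)"
      using binomial_absorption[of n "2 * Suc n"] by simp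
    moreover have "Suc n * ((2 * n + 1) choose n) = (2 * n + 1) * ((2 * n) choose n)"
      using binomial_absorb_comp[of "2 * n + 1" n] by simp
    ultimately have "Suc n * ((2 * Suc n) choose Suc n) = 2 * ((2 * n + 1) * ((2 * n) choose n))"
      by (metis mult.assoc)
    then have "real (Suc n * ((2 * Suc n) choose Suc n)) = real (2 * ((2 * n + 1) * ((2 * n) choose n)))"
      by (simp only:)
    then have "real ((2 * Suc n) choose Suc n) = 2 * (2 * real n + 1) / (real n + 1) * real ((2 * n) choose n)"
      by (simp add: field_simps del: binomial_Suc_Suc mult_Suc_right)
    then have "c (Suc n) = 2 * (2 * real n + 1) / (real n + 1) * real ((2 * n) choose n) / (4 * 4 ^ n)"
      unfolding c_def by (simp only: power_Suc)
    also have "\<dots> = c n * (2 * (2 * real n + 1) / (real n + 1) / 4)"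
      unfolding c_def by (simp only: times_divide_eq_left times_divide_eq_right divide_divide_eq_left mult_ac)
    also have "2 * (2 * real n + 1) / (real n + 1) / 4 = (2 * real n + 1) / (2 * real n + 2)"
      by (simp add: field_simps)
    finally show ?thesis .
  qed
  \<comment> \<open>The partial Wallis product is the reciprocal of (2n+1) c(n)^2, so Wallis's limit
    \<pi>/2 determines the asymptotics of the central binomial coefficient.\<close>
  have W: "W n * ((2 * real n + 1) * (c n)\<^sup>2) = 1" for n
  proof (induction n)
    case 0
    then show ?case by (simp add: W_def c_def)
  next
    case (Suc n)
    define x where "x = real n"
    have x: "x \<ge> 0" by (simp add: x_def)
    define K1 where "K1 = (4 * (x + 1)\<^sup>2) / ((2 * x + 1) * (2 * x + 3))"
    define K2 where "K2 = (2 * x + 1) / (2 * (x + 1))"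
    have "4 * (x + 1)\<^sup>2 - 1 = (2 * x + 1) * (2 * x + 3)"
      by (simp add: power2_eq_square algebra_simps)
    then have WS: "W (Suc n) = W n * K1"
      by (simp add: W_def x_def K1_def add_ac)
    have cS': "c (Suc n) = c n * K2"
      by (simp add: cS K2_def x_def)
    have "K1 * (2 * x + 3) = 4 * (x + 1)\<^sup>2 / (2 * x + 1)"
      using x by (simp add: K1_def)
    moreover have "K2\<^sup>2 = (2 * x + 1)\<^sup>2 / (4 * (x + 1)\<^sup>2)"
      unfolding K2_def power_divide power_mult_distrib by simp
    ultimately have key: "K1 * (2 * x + 3) * K2\<^sup>2 = 2 * x + 1"
      using x by (simp add: power2_eq_square)
    have "W (Suc n) * ((2 * real (Suc n) + 1) * (c (Suc n))\<^sup>2) = W n * ((K1 * (2 * x + 3) * K2\<^sup>2) * (c n)\<^sup>2)"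
      by (simp add: WS cS' power_mult_distrib x_def add_ac)
    then show ?case unfolding key using Suc by (simp add: x_def)
  qed
  have Wpos: "W n \<noteq> 0" for n using W[of n] by auto
  have sq: "real n * (c n)\<^sup>2 = real n / (2 * real n + 1) / W n" for n
  proof -
    have "1 / W n = (2 * real n + 1) * (c n)\<^sup>2"
      using W[of n] Wpos[of n] by (metis nonzero_mult_div_cancel_left)
    then have "real n / (2 * real n + 1) * (1 / W n) = real n / (2 * real n + 1) * ((2 * real n + 1) * (c n)\<^sup>2)"
      by (simp only:)
    then show ?thesis by (simp add: add_nonneg_eq_0_iff)
  qed
  have "W \<longlonglongrightarrow> pi / 2" using wallis unfolding W_def .
  then have "(\<lambda>n. real n / (2 * real n + 1) / W n) \<longlonglongrightarrow> 1 / 2 / (pi / 2)"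
    by (rule tendsto_divide[rotated]) (real_asymp | simp)+
  then have "(\<lambda>n. real n * (c n)\<^sup>2) \<longlonglongrightarrow> 1 / 2 / (pi / 2)"
    unfolding sq .
  then have "(\<lambda>n. sqrt (real n * (c n)\<^sup>2)) \<longlonglongrightarrow> sqrt (1 / pi)"
    by (intro tendsto_real_sqrt) simp
  moreover have "sqrt (real n * (c n)\<^sup>2) = sqrt (real n) * real ((2 * n) choose n) / 4 ^ n" for n
    by (simp add: real_sqrt_mult c_def)
  ultimately show ?thesis by (simp add: real_sqrt_divide)
qed


section \<open>The theta function and the passage to the limit\<close>

text \<open>For Jacobi's \<theta>(x), the sum of exp(-\<pi> n^2 x) over all integers n, this is
  (\<theta>(x) - 1)/2: the constant term is removed so that the rest decays exponentially.\<close>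

definition theta_psi :: "real \<Rightarrow> real" where
  "theta_psi x = (\<Sum>n. exp (- (pi * (real (Suc n))\<^sup>2 * x)))"

lemma exp_neg_square_le:
  fixes c :: real
  assumes "c \<ge> 0"
  shows "exp (- (c * (real (Suc n))\<^sup>2)) \<le> exp (- c) ^ Suc n"
proof -
  have "real (Suc n) * 1 \<le> real (Suc n) * real (Suc n)" by (intro mult_left_mono) auto
  then have "c * real (Suc n) \<le> c * (real (Suc n))\<^sup>2"
    using assms by (intro mult_left_mono) (simp_all add: power2_eq_square)
  moreover have "exp (- c) ^ Suc n = exp (- (c * real (Suc n)))"
    by (simp only: exp_of_nat_mult[symmetric]) (simp add: mult.commute)
  ultimately show ?thesis by simp
qed

lemma summable_exp_neg_power:
  fixes c :: real
  assumes "c > 0"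
  shows "summable (\<lambda>n. exp (- c) ^ Suc n)"
  using assms by (subst summable_Suc_iff) (intro summable_geometric, simp)

lemma summable_exp_neg_square:
  fixes c :: real
  assumes "c > 0"
  shows "summable (\<lambda>n. exp (- (c * (real (Suc n))\<^sup>2)))"
  by (rule summable_comparison_test'[OF summable_exp_neg_power[OF assms], of 0])
     (use exp_neg_square_le[of c] assms in auto)

theorem theta_psi_transformation:
  assumes x: "x > 0"
  shows "1 + 2 * theta_psi (1 / x) = sqrt x * (1 + 2 * theta_psi x)"
proof -
  \<comment> \<open>With m close to \<tau> l^2, the power cos(\<pi>k/l)^(2m) tends to exp(-\<pi>^2
    k^2 \<tau>) and the binomial ratio at distance kl to exp(-k^2/\<tau>). The choice \<tau> =
    x/\<pi> makes these the terms of \<open>theta_psi x\<close> and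
    \<open>theta_psi (1 / x)\<close>.\<close>
  define \<tau> where "\<tau> = x / pi"
  have \<tau>: "\<tau> > 0" using x by (simp add: \<tau>_def)
  define L where "L q = 2 * q + 1" for q :: nat
  define m where "m q = nat \<lfloor>\<tau> * (real (L q))\<^sup>2\<rfloor>" for q
  have L: "real (L q) > 0" for q by (simp add: L_def)
  have m_le: "real (m q) \<le> \<tau> * (real (L q))\<^sup>2" for q
    using \<tau> by (simp add: m_def)
  have m_ge: "\<tau> * (real (L q))\<^sup>2 - 1 \<le> real (m q)" for q
    using \<tau> unfolding m_def by linarith
  have r: "(\<lambda>q. real (m q) / (real (L q))\<^sup>2) \<longlonglongrightarrow> \<tau>"
  proof (rule tendsto_sandwich)
    show "(\<lambda>q. \<tau> - 1 / (real (L q))\<^sup>2) \<longlonglongrightarrow> \<tau>"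
      unfolding L_def by real_asymp
    show "\<forall>\<^sub>F q in sequentially. \<tau> - 1 / (real (L q))\<^sup>2 \<le> real (m q) / (real (L q))\<^sup>2"
    proof (intro always_eventually allI)
      fix q
      have "\<tau> - 1 / (real (L q))\<^sup>2 = (\<tau> * (real (L q))\<^sup>2 - 1) / (real (L q))\<^sup>2"
        using L[of q] by (simp add: diff_divide_distrib)
      also have "\<dots> \<le> real (m q) / (real (L q))\<^sup>2"
        by (intro divide_right_mono m_ge) simp
      finally show "\<tau> - 1 / (real (L q))\<^sup>2 \<le> real (m q) / (real (L q))\<^sup>2" .
    qed
    show "\<forall>\<^sub>F q in sequentially. real (m q) / (real (L q))\<^sup>2 \<le> \<tau>"
      using m_le L by (intro always_eventually allI) (simp add: divide_le_eq)
  qed auto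
  have ev_r: "eventually (\<lambda>q. real (m q) / (real (L q))\<^sup>2 > \<tau> / 2) sequentially"
    using r \<tau> by (intro order_tendstoD(1)[OF r]) auto
  have minf: "filterlim m at_top sequentially"
  proof -
    have "filterlim (\<lambda>q. real (m q)) at_top sequentially"
    proof (rule filterlim_at_top_mono)
      show "filterlim (\<lambda>q. \<tau> * (real (L q))\<^sup>2 - 1) at_top sequentially"
        unfolding L_def using \<tau> by real_asymp
    qed (use m_ge in auto)
    then show ?thesis by (simp add: filterlim_sequentially_iff_filterlim_real)
  qed

  \<comment> \<open>Both finite sums are padded by zeros to infinite series, so that Tannery's
    theorem gives their limits from termwise limits and a summable majorant. The index is shifted,
    \<open>k\<close> standing for the term k + 1.\<close>
  define A where "A k q = (if Suc k \<le> q then cos (pi * real (Suc k) / real (L q)) ^ (2 * m q) else 0)" for k q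
  define B where "B k q = real ((2 * m q) choose (m q + Suc k * L q)) / real ((2 * m q) choose m q)" for k q
  have id: "1 + 2 * (\<Sum>k. A k q) = real (L q) * real ((2 * m q) choose m q) / 4 ^ m q * (1 + 2 * (\<Sum>k. B k q))" for q
  proof -
    have "(\<Sum>k. A k q) = (\<Sum>k<q. A k q)"
      by (rule suminf_finite) (auto simp: A_def)
    also have "\<dots> = (\<Sum>v=1..q. cos (pi * real v / real (L q)) ^ (2 * m q))"
      by (rule sum.reindex_bij_witness[of _ "\<lambda>v. v - 1" Suc]) (auto simp: A_def)
    finally have 1: "(\<Sum>k. A k q) = (\<Sum>v=1..q. cos (pi * real v / real (L q)) ^ (2 * m q))" .
    have "(\<Sum>k. B k q) = (\<Sum>k<m q. B k q)"
    proof (rule suminf_finite)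
      fix k assume "k \<notin> {..<m q}"
      then have "m q < Suc k * 1" by simp
      also have "\<dots> \<le> Suc k * L q"
        by (rule mult_le_mono2) (simp add: L_def)
      finally have "m q < Suc k * L q" .
      then show "B k q = 0" by (simp add: B_def binomial_eq_0)
    qed auto
    also have "\<dots> = (\<Sum>j=1..m q. real ((2 * m q) choose (m q + j * L q)) / real ((2 * m q) choose m q))"
      by (rule sum.reindex_bij_witness[of _ "\<lambda>v. v - 1" Suc]) (auto simp: B_def)
    finally have 2: "real ((2 * m q) choose m q) * (\<Sum>k. B k q) = (\<Sum>j=1..m q. real ((2 * m q) choose (m q + j * L q)))"
      by (simp flip: sum_divide_distrib)
    show ?thesis
      unfolding 1 finite_theta[of q "m q", folded L_def] 2[symmetric] by (simp add: algebra_simps add_divide_distrib)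
  qed

  have limA: "A k \<longlonglongrightarrow> exp (- (pi * (real (Suc k))\<^sup>2 * x))" for k
  proof -
    define c where "c = pi * real (Suc k)"
    have c: "c > 0" by (simp add: c_def)
    have "(\<lambda>q. (real (L q))\<^sup>2 * ln ((cos (c / real (L q)))\<^sup>2)) \<longlonglongrightarrow> - (c * c)"
      unfolding L_def using c by real_asymp
    then have lim: "(\<lambda>q. exp ((real (m q) / (real (L q))\<^sup>2) * ((real (L q))\<^sup>2 * ln ((cos (c / real (L q)))\<^sup>2)))) \<longlonglongrightarrow> exp (\<tau> * - (c * c))"
      by (intro tendsto_intros r)
    have eq: "\<tau> * - (c * c) = - (pi * (real (Suc k))\<^sup>2 * x)"
      by (simp add: \<tau>_def c_def power2_eq_square)
    have ev: "eventually (\<lambda>q. exp ((real (m q) / (real (L q))\<^sup>2) * ((real (L q))\<^sup>2 * ln ((cos (c / real (L q)))\<^sup>2))) = A k q) sequentially"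
      using eventually_ge_at_top[of "Suc k"]
    proof eventually_elim
      case (elim q)
      have "2 * real (Suc k) < real (L q)" using elim by (simp add: L_def)
      then have "pi * (2 * real (Suc k)) < pi * real (L q)" by (rule mult_strict_left_mono) simp
      then have "c / real (L q) < pi / 2"
        using L[of q] by (simp add: c_def field_simps)
      then have "cos (c / real (L q)) > 0"
        using c L[of q] by (intro cos_gt_zero) auto
      then have p: "(cos (c / real (L q)))\<^sup>2 > 0" by simp
      have "exp ((real (m q) / (real (L q))\<^sup>2) * ((real (L q))\<^sup>2 * ln ((cos (c / real (L q)))\<^sup>2))) =
          exp (real (m q) * ln ((cos (c / real (L q)))\<^sup>2))"
        using L[of q] by simp
      also have "\<dots> = ((cos (c / real (L q)))\<^sup>2) ^ m q"
        using p by (simp add: exp_of_nat_mult)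
      also have "\<dots> = A k q" using elim by (simp add: A_def c_def power_mult)
      finally show ?case .
    qed
    show ?thesis using Lim_transform_eventually[OF lim ev] unfolding eq .
  qed
  \<comment> \<open>The majorant is independent of \<open>q\<close> because m/l^2 eventually exceeds
    \<tau>/2; the factor \<pi>^2 is simply bounded below by 1.\<close>
  have boundA: "eventually (\<lambda>(k, q). norm (A k q) \<le> exp (- (\<tau> / 2)) ^ Suc k) (at_top \<times>\<^sub>F sequentially)"
  proof -
    have "eventually (\<lambda>(k :: nat, q). \<tau> / 2 < real (m q) / (real (L q))\<^sup>2) (at_top \<times>\<^sub>F sequentially)"
      using ev_r by (subst eventually_prod2) auto
    then show ?thesis
    proof (rule eventually_mono, clarify)
      fix k q assume *: "\<tau> / 2 < real (m q) / (real (L q))\<^sup>2"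
      show "norm (A k q) \<le> exp (- (\<tau> / 2)) ^ Suc k"
      proof (cases "Suc k \<le> q")
        case True
        define \<alpha> where "\<alpha> = pi * real (Suc k) / real (L q)"
        have "2 * real (Suc k) < real (L q)" using True by (simp add: L_def)
        then have "pi * (2 * real (Suc k)) < pi * real (L q)" by (rule mult_strict_left_mono) simp
        then have a: "0 \<le> \<alpha>" "\<alpha> \<le> pi / 2"
          using L[of q] by (auto simp: \<alpha>_def field_simps)
        have c0: "cos \<alpha> \<ge> 0" using a by (intro cos_ge_zero) auto
        have "cos \<alpha> ^ (2 * m q) \<le> exp (- (\<alpha>\<^sup>2 / 2)) ^ (2 * m q)"
          using a c0 by (intro power_mono cos_le_exp_neg_square) auto
        also have "\<dots> = exp (- (real (m q) * \<alpha>\<^sup>2))"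
          by (simp flip: exp_of_nat_mult)
        also have "real (m q) * \<alpha>\<^sup>2 = pi\<^sup>2 * (real (m q) / (real (L q))\<^sup>2) * (real (Suc k))\<^sup>2"
          by (simp add: \<alpha>_def power_divide power_mult_distrib)
        also have "exp (- (pi\<^sup>2 * (real (m q) / (real (L q))\<^sup>2) * (real (Suc k))\<^sup>2)) \<le> exp (- ((\<tau> / 2) * (real (Suc k))\<^sup>2))"
        proof -
          have "1 \<le> pi\<^sup>2" using pi_gt3 by (intro one_le_power) auto
          then have "1 * (\<tau> / 2) \<le> pi\<^sup>2 * (real (m q) / (real (L q))\<^sup>2)"
            using * \<tau> by (intro mult_mono) auto
          then have "(\<tau> / 2) * (real (Suc k))\<^sup>2 \<le> pi\<^sup>2 * (real (m q) / (real (L q))\<^sup>2) * (real (Suc k))\<^sup>2"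
            by (intro mult_right_mono) auto
          then show ?thesis by simp
        qed
        also have "\<dots> \<le> exp (- (\<tau> / 2)) ^ Suc k"
          using \<tau> by (intro exp_neg_square_le) auto
        finally show ?thesis using True c0 by (simp add: A_def \<alpha>_def)
      qed (simp add: A_def)
    qed
  qed
  have limsumA: "(\<lambda>q. \<Sum>k. A k q) \<longlonglongrightarrow> theta_psi x"
    using tannerys_theorem[OF limA boundA summable_exp_neg_power] \<tau>
    unfolding theta_psi_def by simp

  have limB: "B k \<longlonglongrightarrow> exp (- (pi * (real (Suc k))\<^sup>2 * (1 / x)))" for k
  proof -
    define s where "s = real (Suc k)"
    define a where "a q = Suc k * L q" for q
    have aL: "real (a q) = s * real (L q)" for q by (simp add: a_def s_def algebra_simps)
    have Ba: "B k q = real ((2 * m q) choose (m q + a q)) / real ((2 * m q) choose m q)" for q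
      by (simp only: B_def a_def)
    have t0: "(\<lambda>q. s / real (L q)) \<longlonglongrightarrow> 0" "(\<lambda>q. 1 / (real (L q))\<^sup>2) \<longlonglongrightarrow> 0"
      unfolding L_def by real_asymp+
    have e: "s\<^sup>2 / \<tau> = pi * (real (Suc k))\<^sup>2 * (1 / x)"
      by (simp add: s_def \<tau>_def)
    have e1: "(real (a q))\<^sup>2 / (real (m q) + real (a q)) = s\<^sup>2 / (real (m q) / (real (L q))\<^sup>2 + s / real (L q))" for q
    proof -
      have "real (m q) / (real (L q))\<^sup>2 + s / real (L q) = (real (m q) + real (a q)) / (real (L q))\<^sup>2"
        using L[of q] by (simp add: aL add_divide_distrib power2_eq_square)
      then show ?thesis by (simp add: aL power_mult_distrib)
    qed
    have e2: "(real (a q))\<^sup>2 / (real (m q) - real (a q) + 1) = s\<^sup>2 / (real (m q) / (real (L q))\<^sup>2 - s / real (L q) + 1 / (real (L q))\<^sup>2)" for q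
    proof -
      have "real (m q) / (real (L q))\<^sup>2 - s / real (L q) + 1 / (real (L q))\<^sup>2 = (real (m q) - real (a q) + 1) / (real (L q))\<^sup>2"
        using L[of q] by (simp add: aL add_divide_distrib diff_divide_distrib power2_eq_square)
      then show ?thesis by (simp add: aL power_mult_distrib)
    qed
    have "(\<lambda>q. s\<^sup>2 / (real (m q) / (real (L q))\<^sup>2 + s / real (L q))) \<longlonglongrightarrow> s\<^sup>2 / (\<tau> + 0)"
      using \<tau> by (intro tendsto_intros r t0) auto
    then have u: "(\<lambda>q. exp (- ((real (a q))\<^sup>2 / (real (m q) + real (a q))))) \<longlonglongrightarrow> exp (- (s\<^sup>2 / \<tau>))"
      unfolding e1 by (intro tendsto_exp tendsto_minus) simp
    have "(\<lambda>q. s\<^sup>2 / (real (m q) / (real (L q))\<^sup>2 - s / real (L q) + 1 / (real (L q))\<^sup>2)) \<longlonglongrightarrow> s\<^sup>2 / (\<tau> - 0 + 0)"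
      using \<tau> by (intro tendsto_intros r t0) auto
    then have l: "(\<lambda>q. exp (- ((real (a q))\<^sup>2 / (real (m q) - real (a q) + 1)))) \<longlonglongrightarrow> exp (- (s\<^sup>2 / \<tau>))"
      unfolding e2 by (intro tendsto_exp tendsto_minus) simp
    have "(\<lambda>q. s / real (L q) - real (m q) / (real (L q))\<^sup>2) \<longlonglongrightarrow> 0 - \<tau>"
      by (intro tendsto_intros r t0)
    then have "eventually (\<lambda>q. s / real (L q) - real (m q) / (real (L q))\<^sup>2 < 0) sequentially"
      using \<tau> by (intro order_tendstoD(2)) auto
    then have am: "eventually (\<lambda>q. a q \<le> m q \<and> m q > 0) sequentially"
    proof eventually_elim
      case (elim q)
      have "s / real (L q) - real (m q) / (real (L q))\<^sup>2 = (real (a q) - real (m q)) / (real (L q))\<^sup>2"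
        using L[of q] by (simp add: aL diff_divide_distrib power2_eq_square)
      then have "real (a q) < real (m q)" using elim L[of q] by (simp add: divide_less_0_iff)
      then show ?case by simp
    qed
    have "B k \<longlonglongrightarrow> exp (- (s\<^sup>2 / \<tau>))"
    proof (rule tendsto_sandwich[OF _ _ l u])
      show "eventually (\<lambda>q. exp (- ((real (a q))\<^sup>2 / (real (m q) - real (a q) + 1))) \<le> B k q) sequentially"
        using am by eventually_elim (simp add: Ba central_binomial_ratio_lower)
      show "eventually (\<lambda>q. B k q \<le> exp (- ((real (a q))\<^sup>2 / (real (m q) + real (a q))))) sequentially"
        using am by eventually_elim (simp add: Ba central_binomial_ratio_upper)
    qed
    then show ?thesis unfolding e .
  qed
  \<comment> \<open>For nonzero terms a \<le> m, hence m + a \<le> 2m \<le> 2 \<tau> l^2. This holds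
    for every \<open>q\<close>, without passing to large ones.\<close>
  have boundB: "eventually (\<lambda>(k, q). norm (B k q) \<le> exp (- (1 / (2 * \<tau>))) ^ Suc k) (at_top \<times>\<^sub>F sequentially)"
  proof (intro always_eventually allI, clarify)
    fix k q
    define a where "a = Suc k * L q"
    have Ba: "B k q = real ((2 * m q) choose (m q + a)) / real ((2 * m q) choose m q)"
      by (simp only: B_def a_def)
    show "norm (B k q) \<le> exp (- (1 / (2 * \<tau>))) ^ Suc k"
    proof (cases "a \<le> m q")
      case True
      have a: "real a = real (Suc k) * real (L q)" by (simp add: a_def algebra_simps)
      have "a > 0" by (simp add: a_def L_def)
      then have m0: "m q > 0" using True by simp
      have "B k q \<le> exp (- ((real a)\<^sup>2 / (real (m q) + real a)))"
        using central_binomial_ratio_upper[OF order_refl True m0] by (simp only: Ba)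
      also have "\<dots> \<le> exp (- ((1 / (2 * \<tau>)) * (real (Suc k))\<^sup>2))"
      proof -
        have "(1 / (2 * \<tau>)) * (real (Suc k))\<^sup>2 = (real a)\<^sup>2 / (2 * (\<tau> * (real (L q))\<^sup>2))"
          using L[of q] by (simp add: a power_mult_distrib)
        also have "\<dots> \<le> (real a)\<^sup>2 / (real (m q) + real a)"
          using m_le[of q] True m0 \<tau> L[of q] by (intro divide_left_mono mult_pos_pos) auto
        finally show ?thesis by simp
      qed
      also have "\<dots> \<le> exp (- (1 / (2 * \<tau>))) ^ Suc k"
        using \<tau> by (intro exp_neg_square_le) auto
      finally show ?thesis by (simp add: B_def)
    next
      case False
      then show ?thesis by (simp add: Ba binomial_eq_0)
    qed
  qed
  have limsumB: "(\<lambda>q. \<Sum>k. B k q) \<longlonglongrightarrow> theta_psi (1 / x)"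
    using tannerys_theorem[OF limB boundB summable_exp_neg_power] \<tau>
    unfolding theta_psi_def by simp

  \<comment> \<open>The prefactor is sqrt(m) times the normalised central binomial coefficient,
    divided by sqrt(m/l^2); the limits 1/sqrt(\<pi>) and sqrt(\<tau>) combine to 1/sqrt(x).\<close>
  have limC: "(\<lambda>q. real (L q) * real ((2 * m q) choose m q) / 4 ^ m q) \<longlonglongrightarrow> 1 / sqrt x"
  proof -
    have lim: "(\<lambda>q. (sqrt (real (m q)) * real ((2 * m q) choose m q) / 4 ^ m q) / sqrt (real (m q) / (real (L q))\<^sup>2)) \<longlonglongrightarrow> (1 / sqrt pi) / sqrt \<tau>"
      using \<tau> by (intro tendsto_divide tendsto_real_sqrt r filterlim_compose[OF central_binomial_tendsto minf]) auto
    have ev: "eventually (\<lambda>q. (sqrt (real (m q)) * real ((2 * m q) choose m q) / 4 ^ m q) / sqrt (real (m q) / (real (L q))\<^sup>2) = real (L q) * real ((2 * m q) choose m q) / 4 ^ m q) sequentially"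
      using eventually_gt_at_top[of 0, THEN filterlim_iff[THEN iffD1, OF minf, rule_format]]
      by eventually_elim (simp add: real_sqrt_divide)
    have eq: "(1 / sqrt pi) / sqrt \<tau> = 1 / sqrt x"
      by (simp add: \<tau>_def real_sqrt_divide)
    show ?thesis using Lim_transform_eventually[OF lim ev] unfolding eq .
  qed
  have "(\<lambda>q. 1 + 2 * (\<Sum>k. A k q)) \<longlonglongrightarrow> 1 + 2 * theta_psi x"
    by (intro tendsto_intros limsumA)
  moreover have "(\<lambda>q. 1 + 2 * (\<Sum>k. A k q)) \<longlonglongrightarrow> 1 / sqrt x * (1 + 2 * theta_psi (1 / x))"
    unfolding id by (intro tendsto_intros limsumB limC)
  ultimately have "1 + 2 * theta_psi x = 1 / sqrt x * (1 + 2 * theta_psi (1 / x))"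
    by (rule LIMSEQ_unique)
  then show ?thesis using x by (simp add: field_simps)
qed

section \<open>The integral representation of the completed zeta function\<close>

lemma borel_measurable_theta_psi [measurable]: "theta_psi \<in> borel_measurable borel"
  unfolding theta_psi_def[abs_def] by measurable

lemma summable_theta_psi:
  assumes "x > 0"
  shows "summable (\<lambda>n. exp (- (pi * (real (Suc n))\<^sup>2 * x)))"
  using summable_exp_neg_square[of "pi * x"] assms by (simp add: mult_ac)

lemma theta_psi_ge:
  assumes "x > 0"
  shows "exp (- (pi * x)) \<le> theta_psi x"
proof -
  have "(\<Sum>n\<in>{0}. exp (- (pi * (real (Suc n))\<^sup>2 * x))) \<le> theta_psi x"
    unfolding theta_psi_def by (intro sum_le_suminf summable_theta_psi assms) auto
  then show ?thesis by simp
qed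

lemma theta_psi_nonneg: "x > 0 \<Longrightarrow> 0 \<le> theta_psi x"
  using theta_psi_ge[of x] by (meson exp_ge_zero order_trans)

lemma theta_psi_le:
  assumes "x \<ge> 1"
  shows "theta_psi x \<le> 2 * exp (- (pi * x))"
proof -
  define q where "q = exp (- (pi * x))"
  have "1 * 1 \<le> pi * x" using assms pi_gt3 by (intro mult_mono) auto
  then have "2 \<le> exp (pi * x)"
    using exp_ge_add_one_self[of "pi * x"] by linarith
  then have q: "0 < q" "q \<le> 1 / 2"
    by (auto simp: q_def exp_minus field_simps)
  have geo: "(\<lambda>n. q * q ^ n) sums (q * (1 / (1 - q)))"
    using q by (intro sums_mult geometric_sums) auto
  have "theta_psi x \<le> (\<Sum>n. q * q ^ n)"
    unfolding theta_psi_def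
  proof (rule suminf_le)
    show "exp (- (pi * (real (Suc n))\<^sup>2 * x)) \<le> q * q ^ n" for n
      using exp_neg_square_le[of "pi * x" n] assms by (simp add: q_def mult_ac)
  qed (use assms summable_theta_psi geo in \<open>auto simp: sums_iff\<close>)
  also have "\<dots> = q * (1 / (1 - q))" using geo by (simp add: sums_iff)
  also have "\<dots> \<le> q * 2" using q by (intro mult_left_mono) (auto simp: field_simps)
  finally show ?thesis by (simp add: q_def)
qed

text \<open>Under x = exp(2u) the Mellin transform of \<open>theta_psi\<close> becomes an
  exponential one, and exp(u/2) is what remains after centring at s = 1/2. The polynomial factor s(s
  - 1) stays outside the integral, so nonnegativity is inherited directly from
  \<open>theta_psi\<close>.\<close>

definition xi_density :: "real \<Rightarrow> real" where
  "xi_density u = indicator {0..} u * (exp (u / 2) * theta_psi (exp (2 * u)))"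

definition xi_measure :: "real measure" where
  "xi_measure = density lborel xi_density"

lemma borel_measurable_xi_density [measurable]: "xi_density \<in> borel_measurable borel"
  unfolding xi_density_def[abs_def] by measurable

lemma xi_density_nonneg: "0 \<le> xi_density u"
  by (auto simp: xi_density_def indicator_def intro!: mult_nonneg_nonneg theta_psi_nonneg)

lemma sets_xi_measure [measurable_cong, simp]: "sets xi_measure = sets borel"
  by (simp add: xi_measure_def)

lemma space_xi_measure [simp]: "space xi_measure = UNIV"
  by (simp add: xi_measure_def)

lemma AE_xi_measure_nonneg: "AE u in xi_measure. 0 \<le> u"
  unfolding xi_measure_def by (subst AE_density) (auto simp: xi_density_def indicator_def)

text \<open>The decay rate \<pi> exceeds 3, so after multiplication by exp(exp(2u)) the density is
  still at most 2 exp(-u). This doubly exponential moment dominates every other integrand and later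
  controls the tails of the moments.\<close>

lemma integrable_exp_exp_xi_measure: "integrable xi_measure (\<lambda>u. exp (exp (2 * u)))"
proof -
  have h: "((\<lambda>u :: real. exp (- 1 * u)) has_integral exp (- 1 * 0) / 1) {0..}"
    by (rule has_integral_exp_minus_to_infinity) simp
  have "integral\<^sup>N lborel (\<lambda>u. ennreal (indicator {0..} u * exp (- 1 * u))) = ennreal (exp (- 1 * 0) / 1)"
    using nn_integral_has_integral_lebesgue[OF _ h] by simp
  then have "integrable lborel (\<lambda>u :: real. indicator {0..} u * exp (- 1 * u))"
    by (rule integrableI_nn_integral_finite[rotated 2]) auto
  then have int: "integrable lborel (\<lambda>u :: real. 2 * (indicator {0..} u * exp (- 1 * u)))"
    by (rule integrable_mult_right)
  have "integrable lborel (\<lambda>u. xi_density u *\<^sub>R exp (exp (2 * u)))"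
  proof (rule Bochner_Integration.integrable_bound[OF int])
    show "AE u in lborel. norm (xi_density u *\<^sub>R exp (exp (2 * u))) \<le> norm (2 * (indicator {0..} u * exp (- 1 * u)) :: real)"
    proof (intro AE_I2)
      fix u :: real
      show "norm (xi_density u *\<^sub>R exp (exp (2 * u))) \<le> norm (2 * (indicator {0..} u * exp (- 1 * u)) :: real)"
      proof (cases "u \<ge> 0")
        case True
        define y where "y = exp (2 * u)"
        have y: "1 + 2 * u \<le> y" unfolding y_def by (rule exp_ge_add_one_self)
        have "3 * y \<le> pi * y" using y True pi_gt3 by (intro mult_right_mono) auto
        then have ex: "u / 2 - pi * y + y \<le> - u" using y True by linarith
        have "xi_density u * exp y \<le> (exp (u / 2) * (2 * exp (- (pi * y)))) * exp y"
          using y True theta_psi_le[of y]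
          by (auto simp: xi_density_def indicator_def y_def intro!: mult_right_mono mult_left_mono)
        also have "\<dots> = 2 * exp (u / 2 - pi * y + y)"
        proof -
          have "u / 2 - pi * y + y = u / 2 + - (pi * y) + y" by simp
          then show ?thesis by (simp only: exp_add mult_ac)
        qed
        also have "\<dots> \<le> 2 * exp (- 1 * u)" using ex by simp
        finally show ?thesis
          using True xi_density_nonneg[of u] by (simp add: y_def abs_mult)
      qed (simp add: xi_density_def)
    qed
  qed measurable
  then show ?thesis
    unfolding xi_measure_def by (subst integrable_density) (auto simp: xi_density_nonneg)
qed

text \<open>Since exp(2u) \<ge> 1 + 2u + 2u^2 for u \<ge> 0, completing the square yields a u \<le>
  a^2/8 + exp(2u).\<close>

lemma integrable_exp_xi_measure: "integrable xi_measure (\<lambda>u. exp (a * u))"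
proof (rule Bochner_Integration.integrable_bound)
  show "integrable xi_measure (\<lambda>u. exp (a\<^sup>2 / 8) * exp (exp (2 * u)))"
    by (intro integrable_mult_right integrable_exp_exp_xi_measure)
  show "AE u in xi_measure. norm (exp (a * u)) \<le> norm (exp (a\<^sup>2 / 8) * exp (exp (2 * u)))"
    using AE_xi_measure_nonneg
  proof eventually_elim
    case (elim u)
    have "1 + 2 * u + (2 * u)\<^sup>2 / 2 \<le> exp (2 * u)"
      using elim by (intro exp_lower_Taylor_quadratic) auto
    moreover have "0 \<le> 2 * (u - a / 4)\<^sup>2" by simp
    ultimately have "a * u \<le> a\<^sup>2 / 8 + exp (2 * u)"
      using elim by (simp add: power2_eq_square algebra_simps)
    then show ?case by (simp flip: exp_add)
  qed
qed measurable

lemma even_power_le_cosh: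
  fixes x :: real
  assumes "even n"
  shows "x ^ n / fact n \<le> cosh x"
proof -
  have s: "(\<lambda>n. if even n then x ^ n /\<^sub>R fact n else 0) sums cosh x"
    by (rule cosh_converges)
  have "(\<Sum>k\<in>{n}. if even k then x ^ k /\<^sub>R fact k else 0) \<le> (\<Sum>k. if even k then x ^ k /\<^sub>R fact k else 0)"
    by (rule sum_le_suminf) (use s in \<open>auto simp: sums_iff zero_le_even_power\<close>)
  then show ?thesis using s assms by (simp add: sums_iff divide_inverse mult_ac)
qed

lemma borel_measurable_cosh_mult [measurable]: "(\<lambda>u :: real. cosh (z * u)) \<in> borel_measurable borel"
  by (intro borel_measurable_continuous_onI continuous_intros)

lemma integrable_cosh_xi_measure: "integrable xi_measure (\<lambda>u. cosh (z * u))"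
proof -
  have "integrable xi_measure (\<lambda>u. (exp (z * u) + exp ((- z) * u)) / 2)"
    by (intro Bochner_Integration.integrable_add integrable_divide integrable_exp_xi_measure)
  then show ?thesis by (simp add: cosh_field_def)
qed

lemma integrable_even_power_xi_measure:
  assumes "even n"
  shows "integrable xi_measure (\<lambda>u. u ^ n)"
proof (rule Bochner_Integration.integrable_bound)
  show "integrable xi_measure (\<lambda>u. fact n * cosh (1 * u))"
    by (intro integrable_mult_right integrable_cosh_xi_measure)
  show "AE u in xi_measure. norm (u ^ n) \<le> norm (fact n * cosh (1 * u))"
  proof (intro AE_I2)
    fix u :: real
    show "norm (u ^ n) \<le> norm (fact n * cosh (1 * u))"
      using even_power_le_cosh[OF assms, of u] zero_le_even_power[OF assms, of u]
      by (simp add: field_simps abs_mult)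
  qed
qed measurable

definition xi_moment :: "nat \<Rightarrow> real" where
  "xi_moment n = (LINT u|xi_measure. u ^ n)"

text \<open>Only even powers occur, so all terms are nonnegative; their partial sums are dominated
  by cosh, which is integrable, and termwise integration is allowed.\<close>

lemma cosh_xi_moment_sums:
  "(\<lambda>n. (if even n then xi_moment n / fact n else 0) * z ^ n) sums (LINT u|xi_measure. cosh (z * u))"
proof -
  define f :: "nat \<Rightarrow> real \<Rightarrow> real" where "f n u = (if even n then z ^ n / fact n * u ^ n else 0)" for n u
  have f_nonneg: "0 \<le> f n u" for n u
    by (simp add: f_def zero_le_even_power)
  have f_sums: "(\<lambda>n. f n u) sums cosh (z * u)" for u
    using cosh_converges[of "z * u"]
    by (simp add: f_def power_mult_distrib divide_inverse mult_ac cong: if_cong)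
  have f_int: "integrable xi_measure (f n)" for n
    by (cases "even n") (simp_all add: f_def[abs_def] integrable_even_power_xi_measure)
  have "(\<lambda>n. LINT u|xi_measure. f n u) sums (LINT u|xi_measure. (\<Sum>n. f n u))"
  proof (rule sums_integral[OF f_int])
    show "AE u in xi_measure. summable (\<lambda>n. norm (f n u))"
      using f_sums f_nonneg by (intro AE_I2) (auto simp: sums_iff)
    show "summable (\<lambda>n. LINT u|xi_measure. norm (f n u))"
    proof (rule summableI_nonneg_bounded)
      fix N
      have "(\<Sum>n<N. LINT u|xi_measure. norm (f n u)) = (LINT u|xi_measure. (\<Sum>n<N. f n u))"
        using f_nonneg f_int by simp
      also have "\<dots> \<le> (LINT u|xi_measure. cosh (z * u))"
      proof (rule integral_mono)
        show "(\<Sum>n<N. f n u) \<le> cosh (z * u)" for u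
          using sum_le_suminf[of "\<lambda>n. f n u" "{..<N}"] f_sums[of u] f_nonneg by (simp add: sums_iff)
      qed (use f_int integrable_cosh_xi_measure in auto)
      finally show "(\<Sum>n<N. LINT u|xi_measure. norm (f n u)) \<le> (LINT u|xi_measure. cosh (z * u))" .
    qed simp
  qed
  moreover have "(LINT u|xi_measure. f n u) = (if even n then xi_moment n / fact n else 0) * z ^ n" for n
    by (simp add: f_def xi_moment_def)
  moreover have "(\<Sum>n. f n u) = cosh (z * u)" for u
    using f_sums[of u] by (simp add: sums_iff)
  ultimately show ?thesis by simp
qed

section \<open>Riemann's integral for the completed zeta function at real s > 1\<close>

text \<open>The substitution t = c exp(2u), a bijection from the reals to the positive reals, in
  Euler's integral for Gamma(s/2).\<close>

lemma nn_integral_Gamma_exp: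
  fixes c s :: real
  assumes c: "c > 0" and s: "s > 0"
  shows "(\<integral>\<^sup>+u. ennreal (2 * exp (s * u) * exp (- (c * exp (2 * u)))) \<partial>lborel) =
    ennreal (Gamma (s / 2) * c powr (- (s / 2)))"
proof -
  define f where "f t = t powr (s / 2 - 1) / exp t" for t :: real
  define g where "g u = c * exp (2 * u)" for u :: real
  have img: "g ` UNIV = {0<..}"
  proof -
    have "t \<in> range g" if "t > 0" for t
      using that c by (intro image_eqI[of _ _ "ln (t / c) / 2"]) (auto simp: g_def)
    then show ?thesis using c by (auto simp: g_def)
  qed
  have der: "(g has_field_derivative 2 * g u) (at u within UNIV)" for u
    unfolding g_def by (auto intro!: derivative_eq_intros)
  have inj: "inj_on g UNIV"
    using c by (auto simp: g_def inj_on_def)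
  have "(f has_integral Gamma (s / 2)) {0..}"
    unfolding f_def using s by (intro Gamma_integral_real) auto
  moreover have "(f has_integral Gamma (s / 2)) {0..} \<longleftrightarrow> (f has_integral Gamma (s / 2)) {0<..}"
    by (rule has_integral_spike_set_eq) (rule negligible_subset[of "{0}"]; force)+
  ultimately have fi: "(f has_integral Gamma (s / 2)) {0<..}" by simp
  then have "f absolutely_integrable_on {0<..}" "integral {0<..} f = Gamma (s / 2)"
    by (auto simp: f_def has_integral_iff intro!: nonnegative_absolutely_integrable_1)
  then have "(\<lambda>u. \<bar>2 * g u\<bar> * f (g u)) absolutely_integrable_on UNIV \<and>
      integral UNIV (\<lambda>u. \<bar>2 * g u\<bar> * f (g u)) = Gamma (s / 2)"
    using has_absolute_integral_change_of_variables_1'[of UNIV g "\<lambda>u. 2 * g u" f "Gamma (s / 2)"] der inj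
    unfolding img by simp
  then have "((\<lambda>u. \<bar>2 * g u\<bar> * f (g u)) has_integral Gamma (s / 2)) UNIV"
    by (auto simp: has_integral_iff absolutely_integrable_on_def)
  moreover have "\<bar>2 * g u\<bar> * f (g u) = c powr (s / 2) * (2 * exp (s * u) * exp (- (c * exp (2 * u))))" for u
  proof -
    have "g u > 0" using c by (simp add: g_def)
    then have "\<bar>2 * g u\<bar> * f (g u) = 2 * (g u powr 1 * g u powr (s / 2 - 1)) * exp (- g u)"
      by (simp add: f_def exp_minus field_simps)
    also have "g u powr 1 * g u powr (s / 2 - 1) = g u powr (s / 2)"
      unfolding powr_add[symmetric] by simp
    also have "\<dots> = c powr (s / 2) * exp (s * u)"
      unfolding g_def using c by (simp add: powr_mult exp_powr_real mult_ac)
    finally show ?thesis by (simp add: g_def)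
  qed
  ultimately have "((\<lambda>u. c powr (s / 2) * (2 * exp (s * u) * exp (- (c * exp (2 * u))))) has_integral Gamma (s / 2)) UNIV"
    by simp
  from has_integral_mult_right[OF this, of "c powr (- (s / 2))"]
  have "((\<lambda>u. 2 * exp (s * u) * exp (- (c * exp (2 * u)))) has_integral Gamma (s / 2) * c powr (- (s / 2))) UNIV"
    using c by (simp add: powr_minus field_simps)
  from nn_integral_has_integral_lebesgue[OF _ this] show ?thesis by simp
qed


text \<open>The preceding integral with c = \<pi> n^2, summed over n. Nonnegative integrals commute
  with the series without further conditions.\<close>

lemma nn_integral_theta_psi_exp:
  assumes s: "s > 1"
  shows "(\<integral>\<^sup>+u. ennreal (2 * exp (s * u) * theta_psi (exp (2 * u))) \<partial>lborel) =
    ennreal (Gamma (s / 2) * pi powr (- (s / 2)) * (\<Sum>n. real (Suc n) powr (- s)))"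
proof -
  define h where "h n u = 2 * exp (s * u) * exp (- ((pi * (real (Suc n))\<^sup>2) * exp (2 * u)))" for n u
  have [measurable]: "h n \<in> borel_measurable borel" for n
    unfolding h_def[abs_def] by measurable
  have sums: "(\<lambda>n. h n u) sums (2 * exp (s * u) * theta_psi (exp (2 * u)))" for u
    unfolding h_def theta_psi_def
    by (intro sums_mult summable_sums summable_theta_psi) simp
  have each: "(\<integral>\<^sup>+u. ennreal (h n u) \<partial>lborel) =
      ennreal (Gamma (s / 2) * pi powr (- (s / 2)) * real (Suc n) powr (- s))" for n
  proof -
    have "(pi * (real (Suc n))\<^sup>2) powr (- (s / 2)) = pi powr (- (s / 2)) * ((real (Suc n))\<^sup>2) powr (- (s / 2))"
      by (simp add: powr_mult)
    also have "((real (Suc n))\<^sup>2) powr (- (s / 2)) = real (Suc n) powr (- s)"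
    proof -
      have "(real (Suc n))\<^sup>2 = real (Suc n) powr 2" by (simp only: powr_numeral of_nat_0_less_iff zero_less_Suc)
      then show ?thesis by (simp only: powr_powr) simp
    qed
    finally show ?thesis
      unfolding h_def using nn_integral_Gamma_exp[of "pi * (real (Suc n))\<^sup>2" s] s by (simp add: mult_ac)
  qed
  have "ennreal (2 * exp (s * u) * theta_psi (exp (2 * u))) = (\<Sum>n. ennreal (h n u))" for u
    using sums[of u] by (subst suminf_ennreal2) (auto simp: sums_iff h_def)
  then have "(\<integral>\<^sup>+u. ennreal (2 * exp (s * u) * theta_psi (exp (2 * u))) \<partial>lborel) =
      (\<Sum>n. \<integral>\<^sup>+u. ennreal (h n u) \<partial>lborel)"
    by (simp add: nn_integral_suminf)
  also have "\<dots> = (\<Sum>n. ennreal (Gamma (s / 2) * pi powr (- (s / 2)) * real (Suc n) powr (- s)))"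
    by (simp only: each)
  also have "\<dots> =
      ennreal (\<Sum>n. Gamma (s / 2) * pi powr (- (s / 2)) * real (Suc n) powr (- s))"
  proof (rule suminf_ennreal2)
    show "0 \<le> Gamma (s / 2) * pi powr (- (s / 2)) * real (Suc n) powr (- s)" for n
      using s by (intro mult_nonneg_nonneg less_imp_le[OF Gamma_real_pos]) auto
    have "summable (\<lambda>n. real (Suc n) powr (- s))"
      using s by (subst summable_Suc_iff) (simp add: summable_real_powr_iff)
    then show "summable (\<lambda>n. Gamma (s / 2) * pi powr (- (s / 2)) * real (Suc n) powr (- s))"
      by (rule summable_mult)
  qed
  also have "(\<Sum>n. Gamma (s / 2) * pi powr (- (s / 2)) * real (Suc n) powr (- s)) =
      Gamma (s / 2) * pi powr (- (s / 2)) * (\<Sum>n. real (Suc n) powr (- s))"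
    using s by (intro suminf_mult) (subst summable_Suc_iff, simp add: summable_real_powr_iff)
  finally show ?thesis .
qed

lemma nn_integral_fold_halfline:
  fixes F :: "real \<Rightarrow> ennreal"
  assumes [measurable]: "F \<in> borel_measurable borel"
  shows "(\<integral>\<^sup>+u. F u \<partial>lborel) = (\<integral>\<^sup>+u. indicator {0..} u * (F u + F (- u)) \<partial>lborel)"
proof -
  have "(\<integral>\<^sup>+u. F u \<partial>lborel) = (\<integral>\<^sup>+u. indicator {0..} u * F u + indicator {..<0} u * F u \<partial>lborel)"
    by (intro nn_integral_cong) (auto simp: indicator_def)
  also have "\<dots> = (\<integral>\<^sup>+u. indicator {0..} u * F u \<partial>lborel) + (\<integral>\<^sup>+u. indicator {..<0} u * F u \<partial>lborel)"
    by (rule nn_integral_add) auto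
  also have "(\<integral>\<^sup>+u. indicator {..<0} u * F u \<partial>lborel) = (\<integral>\<^sup>+u. indicator {..<0} (- u) * F (- u) \<partial>lborel)"
    by (subst nn_integral_real_affine[of _ "- 1" 0]) auto
  also have "\<dots> = (\<integral>\<^sup>+u. indicator {0..} u * F (- u) \<partial>lborel)"
  proof (rule nn_integral_cong_AE)
    have "AE u in lborel. u \<noteq> (0 :: real)" by (rule AE_lborel_singleton)
    then show "AE u in lborel. indicator {..<0} (- u) * F (- u) = indicator {0..} u * F (- u)"
      by eventually_elim (auto simp: indicator_def)
  qed
  also have "(\<integral>\<^sup>+u. indicator {0..} u * F u \<partial>lborel) + (\<integral>\<^sup>+u. indicator {0..} u * F (- u) \<partial>lborel) =
      (\<integral>\<^sup>+u. indicator {0..} u * F u + indicator {0..} u * F (- u) \<partial>lborel)"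
    by (rule nn_integral_add[symmetric]) auto
  finally show ?thesis by (simp add: distrib_left)
qed

text \<open>Riemann's argument: fold the integral onto u \<ge> 0 and rewrite
  \<open>theta_psi\<close> at exp(-2u) by the theta transformation. The theta parts combine to a
  cosh against \<open>xi_density\<close>; the leftover exp(-(s-1)u) - exp(-su) integrates to the
  polar terms.\<close>

lemma completed_zeta_real:
  assumes s: "s > 1"
  shows "Gamma (s / 2) * pi powr (- (s / 2)) * (\<Sum>n. real (Suc n) powr (- s)) =
    4 * (LINT u|xi_measure. cosh ((s - 1 / 2) * u)) + (1 / (s - 1) - 1 / s)"
proof -
  define F where "F u = 2 * exp (s * u) * theta_psi (exp (2 * u))" for u
  define C where "C = (LINT u|xi_measure. cosh ((s - 1 / 2) * u))"
  have [measurable]: "F \<in> borel_measurable borel"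
    unfolding F_def[abs_def] by measurable
  have F_nonneg: "0 \<le> F u" for u
    by (simp add: F_def theta_psi_nonneg)
  have refl: "F u + F (- u) = 4 * cosh ((s - 1 / 2) * u) * xi_density u + (exp (- (s - 1) * u) - exp (- s * u))"
    if u: "u \<ge> 0" for u
  proof -
    define T where "T = theta_psi (exp (2 * u))"
    have sq: "sqrt (exp (2 * u)) = exp u"
      by (simp add: real_sqrt_unique exp_double)
    have "exp (2 * (- u)) = 1 / exp (2 * u)" by (simp add: exp_minus field_simps)
    then have "1 + 2 * theta_psi (exp (2 * (- u))) = exp u * (1 + 2 * T)"
      using theta_psi_transformation[of "exp (2 * u)"] by (simp add: T_def sq)
    then have "2 * theta_psi (exp (2 * (- u))) = exp u * (1 + 2 * T) - 1" by linarith
    moreover have "F (- u) = exp (- s * u) * (2 * theta_psi (exp (2 * (- u))))" by (simp add: F_def)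
    ultimately have "F (- u) = exp (- s * u) * (exp u * (1 + 2 * T) - 1)" by (simp only:)
    also have "\<dots> = exp (- s * u + u) * (1 + 2 * T) - exp (- s * u)"
      by (simp only: exp_add) (simp add: algebra_simps)
    also have "- s * u + u = - (s - 1) * u" by (simp add: algebra_simps)
    finally have "F u + F (- u) = 2 * (exp (s * u) + exp (- (s - 1) * u)) * T + (exp (- (s - 1) * u) - exp (- s * u))"
      by (simp add: F_def T_def algebra_simps)
    also have "exp (s * u) + exp (- (s - 1) * u) = 2 * cosh ((s - 1 / 2) * u) * exp (u / 2)"
    proof -
      have "s * u = (s - 1 / 2) * u + u / 2" "- (s - 1) * u = - ((s - 1 / 2) * u) + u / 2"
        by (simp_all add: field_simps)
      then show ?thesis by (simp only: exp_add) (simp add: cosh_field_def algebra_simps)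
    qed
    also have "2 * (2 * cosh ((s - 1 / 2) * u) * exp (u / 2)) * T = 4 * cosh ((s - 1 / 2) * u) * xi_density u"
      using u by (simp add: xi_density_def T_def)
    finally show ?thesis .
  qed
  have ge: "exp (- (s - 1) * u) - exp (- s * u) \<ge> 0" if "u \<ge> 0" for u
    using that by (simp add: algebra_simps)
  have int: "integrable lborel (\<lambda>u. xi_density u *\<^sub>R cosh ((s - 1 / 2) * u))"
    using integrable_cosh_xi_measure[of "s - 1 / 2"] unfolding xi_measure_def
    by (subst (asm) integrable_density) (auto simp: xi_density_nonneg)
  have Ceq: "C = (LINT u|lborel. xi_density u *\<^sub>R cosh ((s - 1 / 2) * u))"
    unfolding C_def xi_measure_def by (subst integral_density) (auto simp: xi_density_nonneg)
  have "ennreal (Gamma (s / 2) * pi powr (- (s / 2)) * (\<Sum>n. real (Suc n) powr (- s))) = (\<integral>\<^sup>+u. ennreal (F u) \<partial>lborel)"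
    using nn_integral_theta_psi_exp[OF s] by (simp add: F_def)
  also have "\<dots> = (\<integral>\<^sup>+u. indicator {0..} u * (ennreal (F u) + ennreal (F (- u))) \<partial>lborel)"
    by (rule nn_integral_fold_halfline) measurable
  also have "\<dots> = (\<integral>\<^sup>+u. ennreal (4 * (xi_density u *\<^sub>R cosh ((s - 1 / 2) * u))) +
      ennreal (indicator {0..} u * (exp (- (s - 1) * u) - exp (- s * u))) \<partial>lborel)"
  proof (rule nn_integral_cong)
    fix u :: real
    show "indicator {0..} u * (ennreal (F u) + ennreal (F (- u))) =
        ennreal (4 * (xi_density u *\<^sub>R cosh ((s - 1 / 2) * u))) +
        ennreal (indicator {0..} u * (exp (- (s - 1) * u) - exp (- s * u)))"
    proof (cases "u \<ge> 0")
      case True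
      have "ennreal (F u) + ennreal (F (- u)) = ennreal (F u + F (- u))"
        using F_nonneg by (simp add: ennreal_plus)
      also have "F u + F (- u) = 4 * (xi_density u *\<^sub>R cosh ((s - 1 / 2) * u)) + (exp (- (s - 1) * u) - exp (- s * u))"
        unfolding refl[OF True] by simp
      also have "ennreal \<dots> = ennreal (4 * (xi_density u *\<^sub>R cosh ((s - 1 / 2) * u))) + ennreal (exp (- (s - 1) * u) - exp (- s * u))"
        using ge[OF True] xi_density_nonneg[of u] by (intro ennreal_plus) auto
      finally show ?thesis using True by simp
    qed (simp add: xi_density_def)
  qed
  also have "\<dots> = (\<integral>\<^sup>+u. ennreal (4 * (xi_density u *\<^sub>R cosh ((s - 1 / 2) * u))) \<partial>lborel) +
      (\<integral>\<^sup>+u. ennreal (indicator {0..} u * (exp (- (s - 1) * u) - exp (- s * u))) \<partial>lborel)"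
    by (rule nn_integral_add) measurable
  also have "(\<integral>\<^sup>+u. ennreal (4 * (xi_density u *\<^sub>R cosh ((s - 1 / 2) * u))) \<partial>lborel) = ennreal (4 * C)"
    unfolding Ceq using int xi_density_nonneg
    by (subst nn_integral_eq_integral) auto
  also have "(\<integral>\<^sup>+u. ennreal (indicator {0..} u * (exp (- (s - 1) * u) - exp (- s * u))) \<partial>lborel) =
      ennreal (1 / (s - 1) - 1 / s)"
  proof -
    have "((\<lambda>u. exp (- (s - 1) * u) - exp (- s * u)) has_integral
        (exp (- (s - 1) * 0) / (s - 1) - exp (- s * 0) / s)) {0..}"
      using s by (intro has_integral_diff has_integral_exp_minus_to_infinity) auto
    from nn_integral_has_integral_lebesgue[OF _ this] ge show ?thesis by simp
  qed
  also have "ennreal (4 * C) + ennreal (1 / (s - 1) - 1 / s) = ennreal (4 * C + (1 / (s - 1) - 1 / s))"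
  proof (rule ennreal_plus[symmetric])
    show "0 \<le> 4 * C" unfolding C_def by (simp add: integral_nonneg_AE)
    show "0 \<le> 1 / (s - 1) - 1 / s" using s by (simp add: field_simps)
  qed
  finally have "ennreal (Gamma (s / 2) * pi powr (- (s / 2)) * (\<Sum>n. real (Suc n) powr (- s))) =
      ennreal (4 * C + (1 / (s - 1) - 1 / s))" .
  moreover have "0 \<le> Gamma (s / 2) * pi powr (- (s / 2)) * (\<Sum>n. real (Suc n) powr (- s))"
    using s by (intro mult_nonneg_nonneg less_imp_le[OF Gamma_real_pos] suminf_nonneg)
      (auto simp: summable_Suc_iff[of "\<lambda>n. real n powr (- s)"] summable_real_powr_iff simp del: of_nat_Suc)
  moreover have "0 \<le> 4 * C + (1 / (s - 1) - 1 / s)"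
    using s unfolding C_def by (intro add_nonneg_nonneg) (auto simp: field_simps integral_nonneg_AE)
  ultimately show ?thesis unfolding C_def by (subst (asm) ennreal_inj) auto
qed

section \<open>Taylor coefficients of xi\<close>

text \<open>The expansion at 0 of 4 times the cosh integral over \<open>xi_measure\<close>.
  Evaluating the series extends that function to complex arguments without complex-valued
  integrals.\<close>

definition xi_fps :: "complex fps" where
  "xi_fps = Abs_fps (\<lambda>n. if even n then of_real (4 * (xi_moment n / fact n)) else 0)"

lemma xi_fps_sums:
  "(\<lambda>n. fps_nth xi_fps n * of_real x ^ n) sums of_real (4 * (LINT u|xi_measure. cosh (x * u)))"
proof -
  have "(\<lambda>n. complex_of_real (4 * ((if even n then xi_moment n / fact n else 0) * x ^ n))) sums
      of_real (4 * (LINT u|xi_measure. cosh (x * u)))"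
    by (intro sums_of_real sums_mult cosh_xi_moment_sums)
  also have "(\<lambda>n. complex_of_real (4 * ((if even n then xi_moment n / fact n else 0) * x ^ n))) =
      (\<lambda>n. fps_nth xi_fps n * of_real x ^ n)"
    by (auto simp: xi_fps_def fun_eq_iff)
  finally show ?thesis .
qed

text \<open>Convergence at one point of each modulus suffices, and the positive reals are such
  points.\<close>

lemma fps_conv_radius_xi_fps [simp]: "fps_conv_radius xi_fps = \<infinity>"
  unfolding fps_conv_radius_def
proof (rule conv_radius_inftyI'[of 0])
  fix r :: real assume "r > 0"
  then show "\<exists>z. norm z = r \<and> summable (\<lambda>n. fps_nth xi_fps n * z ^ n)"
    using xi_fps_sums[of r] by (intro exI[of _ "of_real r"]) (auto simp: sums_iff)
qed

lemma eval_xi_fps_of_real: "eval_fps xi_fps (of_real x) = of_real (4 * (LINT u|xi_measure. cosh (x * u)))"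
  using xi_fps_sums[of x] by (simp only: eval_fps_def sums_iff)

section \<open>Identification with the continued zeta function and with xi\<close>

text \<open>Multiplying the completed zeta function by s(s - 1)/2 turns the polar terms 1/(s-1) -
  1/s into the constant 1/2.\<close>

definition xi_entire :: "complex \<Rightarrow> complex" where
  "xi_entire s = 1 / 2 + s * (s - 1) / 2 * eval_fps xi_fps (s - 1 / 2)"

lemma holomorphic_xi_entire: "xi_entire holomorphic_on S"
proof -
  have "eval_fps xi_fps holomorphic_on UNIV"
    by (rule holomorphic_on_eval_fps) auto
  then have "(\<lambda>s. eval_fps xi_fps (s - 1 / 2)) holomorphic_on S"
    by (rule holomorphic_on_compose_gen[of "\<lambda>s. s - 1 / 2" S _ UNIV, unfolded o_def, rotated])
       (auto intro!: holomorphic_intros)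
  then show ?thesis
    unfolding xi_entire_def[abs_def] by (intro holomorphic_intros) auto
qed

text \<open>The product defining xi, solved for zeta. With (s/2) Gamma(s/2) = Gamma(s/2 + 1) and the
  entire function \<open>rGamma\<close>, the formula is regular at 0 and at the negative even
  integers; only s = 1 needs a separate value.\<close>

definition zeta_cont :: "complex \<Rightarrow> complex" where
  "zeta_cont s = (if s = 1 then 0 else xi_entire s * of_real pi powr (s / 2) * rGamma (s / 2 + 1) / (s - 1))"

lemma holomorphic_zeta_cont: "zeta_cont holomorphic_on (- {1})"
proof -
  have "(\<lambda>s. xi_entire s * of_real pi powr (s / 2) * rGamma (s / 2 + 1) / (s - 1)) holomorphic_on (- {1})"
    by (intro holomorphic_intros holomorphic_xi_entire) auto
  then show ?thesis
    by (rule holomorphic_transform) (auto simp: zeta_cont_def)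
qed

lemma zeta_cont_of_real:
  assumes x: "x > 1"
  shows "zeta_cont (of_real x) = of_real (\<Sum>n. real (Suc n) powr (- x))"
proof -
  define Z where "Z = (\<Sum>n. real (Suc n) powr (- x))"
  define G where "G = Gamma (x / 2) * pi powr (- (x / 2)) * Z"
  have "4 * (LINT u|xi_measure. cosh ((x - 1 / 2) * u)) = G - (1 / (x - 1) - 1 / x)"
    using completed_zeta_real[OF x] by (simp add: G_def Z_def)
  then have J: "eval_fps xi_fps (of_real x - 1 / 2) = of_real (G - (1 / (x - 1) - 1 / x))"
    using eval_xi_fps_of_real[of "x - 1 / 2"] by simp
  have "xi_entire (of_real x) = of_real (1 / 2 + x * (x - 1) / 2 * (G - (1 / (x - 1) - 1 / x)))"
    unfolding xi_entire_def J by simp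
  also have "1 / 2 + x * (x - 1) / 2 * (G - (1 / (x - 1) - 1 / x)) = x * (x - 1) / 2 * G"
  proof -
    have "x * (x - 1) / 2 * (1 / (x - 1) - 1 / x) = 1 / 2"
      using x by (simp add: field_simps)
    then show ?thesis by (simp only: right_diff_distrib)
  qed
  finally have X: "xi_entire (of_real x) = of_real (x * (x - 1) / 2 * G)" .
  have P: "complex_of_real pi powr (of_real x / 2) = of_real (pi powr (x / 2))"
    using powr_of_real[of pi "x / 2"] by simp
  have R: "rGamma (complex_of_real x / 2 + 1) = of_real (rGamma (x / 2 + 1))"
    using rGamma_complex_of_real[of "x / 2 + 1"] by simp
  have "zeta_cont (of_real x) = of_real (x * (x - 1) / 2 * G * pi powr (x / 2) * rGamma (x / 2 + 1) / (x - 1))"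
    using x unfolding zeta_cont_def X P R by simp
  also have "x * (x - 1) / 2 * G * pi powr (x / 2) * rGamma (x / 2 + 1) / (x - 1) = Z"
  proof -
    have 1: "Gamma (x / 2 + 1) = x / 2 * Gamma (x / 2)"
      using x by (intro Gamma_plus1) auto
    have "Gamma (x / 2) > 0" using x by (intro Gamma_real_pos) auto
    then have "x / 2 * Gamma (x / 2) > 0" using x by (intro mult_pos_pos) auto
    then have 2: "x / 2 * Gamma (x / 2) \<noteq> 0" by (metis less_irrefl)
    have 3: "pi powr (- (x / 2)) * pi powr (x / 2) = 1" by (simp flip: powr_add)
    have "x * (x - 1) / 2 * G * pi powr (x / 2) * rGamma (x / 2 + 1) / (x - 1) =
        (x / 2 * Gamma (x / 2) * rGamma (x / 2 + 1)) * (pi powr (- (x / 2)) * pi powr (x / 2)) * Z"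
    proof -
      have "x * y / 2 * G * pi powr (x / 2) * rGamma (x / 2 + 1) / y =
          x / 2 * G * pi powr (x / 2) * rGamma (x / 2 + 1)" if "y \<noteq> 0" for y
        using that by simp
      from this[of "x - 1"] show ?thesis using x by (simp add: G_def mult_ac)
    qed
    also have "x / 2 * Gamma (x / 2) * rGamma (x / 2 + 1) = 1"
      unfolding rGamma_inverse_Gamma 1 using 2 by (rule right_inverse)
    finally show ?thesis unfolding 3 by simp
  qed
  finally show ?thesis by (simp add: Z_def)
qed

lemma holomorphic_dirichlet_zeta:
  "(\<lambda>s. \<Sum>k. of_nat (Suc k) powr (- s)) holomorphic_on {s :: complex. Re s > 1}"
proof (rule holomorphic_uniform_sequence[where f = "\<lambda>n s. \<Sum>k<n. of_nat (Suc k) powr (- s)"])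
  show "open {s. Re s > 1}" by (rule open_halfspace_Re_gt)
  show "(\<lambda>s. \<Sum>k<n. of_nat (Suc k) powr (- s)) holomorphic_on {s. Re s > 1}" for n
    by (intro holomorphic_intros) (auto simp del: of_nat_Suc)
  fix x :: complex assume x: "x \<in> {s. Re s > 1}"
  \<comment> \<open>Half the distance from \<open>x\<close> to the line Re s = 1, so that Re s \<ge>
    1 + d on the whole disc and the M-test applies.\<close>
  define d where "d = (Re x - 1) / 2"
  have d: "d > 0" using x by (simp add: d_def)
  have Re_ge: "Re s \<ge> 1 + d" if "s \<in> cball x d" for s
  proof -
    have "\<bar>Re (x - s)\<bar> \<le> d"
      using that abs_Re_le_cmod[of "x - s"] by (simp add: dist_norm)
    then have "Re x - Re s \<le> d" by (simp add: abs_le_iff)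
    moreover have "Re x = 1 + 2 * d" by (simp add: d_def field_simps)
    ultimately show ?thesis by linarith
  qed
  have "uniform_limit (cball x d) (\<lambda>n s. \<Sum>k<n. of_nat (Suc k) powr (- s)) (\<lambda>s. \<Sum>k. of_nat (Suc k) powr (- s)) sequentially"
  proof (rule Weierstrass_m_test)
    show "norm (of_nat (Suc k) powr (- s)) \<le> real (Suc k) powr (- (1 + d))" if "s \<in> cball x d" for k s
    proof -
      have "norm (of_nat (Suc k) powr (- s)) = real (Suc k) powr (- Re s)"
        using norm_powr_real_powr[of "of_nat (Suc k)" "- s"] by (simp del: of_nat_Suc)
      also have "\<dots> \<le> real (Suc k) powr (- (1 + d))"
        using Re_ge[OF that] by (intro powr_mono) auto
      finally show ?thesis .
    qed
    show "summable (\<lambda>k. real (Suc k) powr (- (1 + d)))"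
      using d by (subst summable_Suc_iff) (simp add: summable_real_powr_iff)
  qed
  moreover have "cball x d \<subseteq> {s. Re s > 1}"
    using Re_ge d by (auto intro: less_le_trans[of 1 "1 + d"])
  ultimately show "\<exists>d>0. cball x d \<subseteq> {s. Re s > 1} \<and>
      uniform_limit (cball x d) (\<lambda>n s. \<Sum>k<n. of_nat (Suc k) powr (- s)) (\<lambda>s. \<Sum>k. of_nat (Suc k) powr (- s)) sequentially"
    using d by blast
qed

text \<open>Equality is known on the real ray beyond 1, which has the accumulation point 2 inside
  the half-plane; the identity theorem does the rest.\<close>

lemma zeta_cont_eq_dirichlet:
  assumes "Re s > 1"
  shows "zeta_cont s = (\<Sum>k. of_nat (Suc k) powr (- s))"
proof -
  define U where "U = {s. Im s = 0 \<and> Re s > 1}"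
  have "zeta_cont s - (\<Sum>k. of_nat (Suc k) powr (- s)) = 0"
  proof (rule analytic_continuation[where f = "\<lambda>s. zeta_cont s - (\<Sum>k. of_nat (Suc k) powr (- s))"
        and w = s and S = "{s. Re s > 1}" and U = U and \<xi> = 2])
    show "(\<lambda>s. zeta_cont s - (\<Sum>k. of_nat (Suc k) powr (- s))) holomorphic_on {s. Re s > 1}"
      by (intro holomorphic_on_diff holomorphic_dirichlet_zeta holomorphic_on_subset[OF holomorphic_zeta_cont]) auto
    show "open {s. Re s > 1}" by (rule open_halfspace_Re_gt)
    show "connected {s. Re s > 1}" by (intro convex_connected convex_halfspace_Re_gt)
    show "2 islimpt U"
      unfolding islimpt_approachable
    proof (intro allI impI)
      fix e :: real assume e: "e > 0"
      show "\<exists>x'\<in>U. x' \<noteq> 2 \<and> dist x' 2 < e"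
        using e by (intro bexI[of _ "of_real (2 + e / 2)"]) (auto simp: U_def dist_norm complex_eq_iff)
    qed
    fix z assume z: "z \<in> U"
    define x where "x = Re z"
    have zx: "z = of_real x" "x > 1" using z by (auto simp: U_def x_def complex_eq_iff)
    have "(\<lambda>k. complex_of_real (real (Suc k) powr (- x))) sums of_real (\<Sum>k. real (Suc k) powr (- x))"
      using zx(2) by (intro sums_of_real summable_sums) (subst summable_Suc_iff, simp add: summable_real_powr_iff)
    moreover have "complex_of_real (real (Suc k) powr (- x)) = of_nat (Suc k) powr (- z)" for k
      unfolding zx(1) using powr_of_real[of "real (Suc k)" "- x"] by (simp del: of_nat_Suc)
    ultimately have "(\<Sum>k. of_nat (Suc k) powr (- z)) = of_real (\<Sum>k. real (Suc k) powr (- x))"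
      by (simp add: sums_iff del: of_nat_Suc)
    then show "zeta_cont z - (\<Sum>k. of_nat (Suc k) powr (- z)) = 0"
      unfolding zx(1) zeta_cont_of_real[OF zx(2)] by simp
  qed (use assms in \<open>auto simp: U_def\<close>)
  then show ?thesis by simp
qed

lemma riemann_zeta_eq: "riemann_zeta = zeta_cont"
  unfolding riemann_zeta_def
proof (rule the_equality)
  show "zeta_cont holomorphic_on - {1} \<and>
      (\<forall>s. Re s > 1 \<longrightarrow> zeta_cont s = (\<Sum>k. of_nat (Suc k) powr (- s))) \<and> zeta_cont 1 = 0"
    using holomorphic_zeta_cont zeta_cont_eq_dirichlet by (auto simp: zeta_cont_def)
  fix f :: "complex \<Rightarrow> complex"
  assume f: "f holomorphic_on - {1} \<and> (\<forall>s. Re s > 1 \<longrightarrow> f s = (\<Sum>k. of_nat (Suc k) powr (- s))) \<and> f 1 = 0"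
  show "f = zeta_cont"
  proof
    fix s
    show "f s = zeta_cont s"
    proof (cases "s = 1")
      case False
      show ?thesis
      proof (rule analytic_continuation_open[of "{s. Re s > 1}" "- {1}" f zeta_cont s])
        show "open {s. Re s > 1}" by (rule open_halfspace_Re_gt)
        have "2 \<in> {s :: complex. Re s > 1}" by simp
        then show "{s :: complex. Re s > 1} \<noteq> {}" by blast
        show "connected (- {1 :: complex})"
          by (rule connected_punctured_universe) simp
      qed (use f False holomorphic_zeta_cont zeta_cont_eq_dirichlet in auto)
    qed (use f in \<open>simp add: zeta_cont_def\<close>)
  qed
qed

text \<open>This disc avoids 0, 1 and the poles of the Gamma factor, so \<open>remove_sings\<close>
  leaves the product unchanged there. A neighbourhood of 1/2 is all that the derivatives in
  \<open>xi_gamma\<close> see.\<close>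

lemma riemann_xi_eq:
  assumes "s \<in> ball (1 / 2) (1 / 2)"
  shows "riemann_xi s = xi_entire s"
proof -
  define f where "f s = 1 / 2 * s * (s - 1) * of_real pi powr (- s / 2) * Gamma (s / 2) * riemann_zeta s" for s
  have f: "f s = xi_entire s" if "s \<in> ball (1 / 2) (1 / 2)" for s
  proof -
    have "norm (1 / 2 - s) < 1 / 2" using that by (simp add: dist_norm)
    then have "\<bar>Re (1 / 2 - s)\<bar> < 1 / 2" using abs_Re_le_cmod[of "1 / 2 - s"] by linarith
    moreover have "Re (1 / 2 - s) = 1 / 2 - Re s" by simp
    ultimately have re: "0 < Re s" "Re s < 1" by linarith+
    then have s: "s \<noteq> 0" "s \<noteq> 1" by auto
    have nn: "s / 2 \<notin> \<int>\<^sub>\<le>\<^sub>0" using re by (auto elim!: nonpos_Ints_cases)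
    have eq: "Gamma (s / 2 + 1) = s / 2 * Gamma (s / 2)" using nn by (rule Gamma_plus1)
    have "s / 2 * Gamma (s / 2) \<noteq> 0" using nn s by (simp add: Gamma_eq_zero_iff)
    then have 1: "s / 2 * Gamma (s / 2) * rGamma (s / 2 + 1) = 1"
      unfolding rGamma_inverse_Gamma eq by (rule right_inverse)
    have 2: "complex_of_real pi powr (- s / 2) * of_real pi powr (s / 2) = 1"
      by (simp flip: powr_add)
    have "f s = xi_entire s * (s / 2 * Gamma (s / 2) * rGamma (s / 2 + 1)) * (of_real pi powr (- s / 2) * of_real pi powr (s / 2))"
    proof -
      have aux: "1 / 2 * s * y * A * B * (X * P * R / y) = X * (s / 2 * B * R) * (A * P)"
        if "y \<noteq> 0" for y A B X P R :: complex
        using that by simp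
      show ?thesis
        unfolding f_def riemann_zeta_eq zeta_cont_def using s by (simp only: if_False) (rule aux, simp)
    qed
    then show ?thesis unfolding 1 2 by simp
  qed
  have "xi_entire holomorphic_on ball (1 / 2) (1 / 2)" by (rule holomorphic_xi_entire)
  then have "f holomorphic_on ball (1 / 2) (1 / 2)"
    by (rule holomorphic_transform) (simp add: f)
  then have "f analytic_on {s}"
    using assms by (metis analytic_at open_ball)
  then have "remove_sings f s = f s" by (rule remove_sings_at_analytic)
  then show ?thesis using f[OF assms] by (simp add: riemann_xi_def f_def[abs_def])
qed

definition xi_coeff :: "nat \<Rightarrow> real" where
  "xi_coeff m = 4 * (xi_moment (2 * m) / fact (2 * m))"

text \<open>With s = 1/2 + z the factor s(s - 1) becomes z^2 - 1/4: it shifts the even coefficients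
  by one and subtracts a quarter of the unshifted one. Index 0 is left out because the constant 1/2
  of \<open>xi_entire\<close> enters there.\<close>

lemma xi_gamma_Suc:
  "xi_gamma (Suc m) = of_real (fact (Suc m) * (xi_coeff m - xi_coeff (Suc m) / 4) / 2)"
proof -
  define F where "F = fps_const (1 / 2) + fps_const (1 / 2) * (fps_X ^ 2 - fps_const (1 / 4)) * xi_fps"
  have "eval_fps xi_fps has_fps_expansion xi_fps"
    by (rule eval_fps_has_fps_expansion) simp
  then have "(\<lambda>z. 1 / 2 + 1 / 2 * (z ^ 2 - 1 / 4) * eval_fps xi_fps z) has_fps_expansion F"
    unfolding F_def by (intro fps_expansion_intros)
  also have "(\<lambda>z. 1 / 2 + 1 / 2 * (z ^ 2 - 1 / 4) * eval_fps xi_fps z) = (\<lambda>z. xi_entire (1 / 2 + z))"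
    by (simp add: fun_eq_iff xi_entire_def power2_eq_square field_simps)
  finally have F: "(\<lambda>z. xi_entire (1 / 2 + z)) has_fps_expansion F" .
  have "(deriv ^^ (2 * Suc m)) riemann_xi (1 / 2) = (deriv ^^ (2 * Suc m)) (\<lambda>z. riemann_xi (1 / 2 + z)) 0"
    by (subst higher_deriv_shift_0) (simp only: o_def)
  also have "\<dots> = (deriv ^^ (2 * Suc m)) (\<lambda>z. xi_entire (1 / 2 + z)) 0"
  proof (rule higher_deriv_cong_ev)
    have "eventually (\<lambda>z :: complex. z \<in> ball 0 (1 / 2)) (nhds 0)"
      by (intro eventually_nhds_in_open) auto
    then show "eventually (\<lambda>z. riemann_xi (1 / 2 + z) = xi_entire (1 / 2 + z)) (nhds 0)"
      by eventually_elim (intro riemann_xi_eq, simp add: dist_norm)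
  qed simp
  also have "\<dots> = fact (2 * Suc m) * fps_nth F (2 * Suc m)"
    using fps_nth_fps_expansion[OF F, of "2 * Suc m"] by (simp del: fact_Suc mult_Suc_right)
  also have "fps_nth F (2 * Suc m) = 1 / 2 * (fps_nth xi_fps (2 * m) - 1 / 4 * fps_nth xi_fps (2 * Suc m))"
    unfolding F_def by (simp add: fps_X_power_mult_nth left_diff_distrib mult.assoc fps_mult_left_const_nth)
  also have "\<dots> = of_real ((xi_coeff m - xi_coeff (Suc m) / 4) / 2)"
    by (simp add: xi_fps_def xi_coeff_def del: fact_Suc mult_Suc_right)
  finally have d: "(deriv ^^ (2 * Suc m)) riemann_xi (1 / 2) =
      fact (2 * Suc m) * of_real ((xi_coeff m - xi_coeff (Suc m) / 4) / 2)" .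
  show ?thesis
    unfolding xi_gamma_def d by (simp del: fact_Suc mult_Suc_right)
qed

section \<open>Growth of the Taylor coefficients\<close>

lemma integrable_indicator_xi_measure: "integrable xi_measure (\<lambda>u. indicator {1..2} u :: real)"
proof (rule Bochner_Integration.integrable_bound)
  show "integrable xi_measure (\<lambda>u. exp (0 * u))" by (rule integrable_exp_xi_measure)
qed (auto simp: indicator_def)

text \<open>On [1, 2] every even power is at least 1, so the mass of this interval bounds all even
  moments. Being independent of n, the bound absorbs error terms that tend to 0.\<close>

lemma xi_moment_lower_bound: "\<exists>\<delta>>0. \<forall>n. even n \<longrightarrow> \<delta> \<le> xi_moment n"
proof -
  \<comment> \<open>A lower bound for the density on [1, 2], where exp(2u) \<le> exp 4.\<close>
  define c where "c = exp (- (pi * exp 4))"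
  have "c * 1 \<le> (LINT u|xi_measure. indicator {1..2} u)"
  proof -
    have "c * 1 = (LINT u|lborel. c * indicator {1..2 :: real} u)" by simp
    also have "\<dots> \<le> (LINT u|lborel. xi_density u *\<^sub>R indicator {1..2} u)"
    proof (rule integral_mono)
      show "integrable lborel (\<lambda>u. c * indicator {1..2 :: real} u)" by simp
      show "integrable lborel (\<lambda>u. xi_density u *\<^sub>R indicator {1..2} u :: real)"
        using integrable_indicator_xi_measure unfolding xi_measure_def
        by (subst (asm) integrable_density) (auto simp: xi_density_nonneg)
      fix u :: real
      show "c * indicator {1..2} u \<le> xi_density u *\<^sub>R indicator {1..2} u"
      proof (cases "u \<in> {1..2}")
        case True
        have "c \<le> exp (- (pi * exp (2 * u)))" using True by (simp add: c_def)
        also have "\<dots> \<le> theta_psi (exp (2 * u))" by (rule theta_psi_ge) simp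
        also have "1 * theta_psi (exp (2 * u)) \<le> exp (u / 2) * theta_psi (exp (2 * u))"
          using True by (intro mult_right_mono theta_psi_nonneg) auto
        finally show ?thesis using True by (simp add: xi_density_def)
      qed simp
    qed
    also have "\<dots> = (LINT u|xi_measure. indicator {1..2} u)"
      unfolding xi_measure_def by (subst integral_density) (auto simp: xi_density_nonneg)
    finally show ?thesis .
  qed
  moreover have "(LINT u|xi_measure. indicator {1..2} u) \<le> xi_moment n" if n: "even n" for n
    unfolding xi_moment_def
  proof (rule integral_mono[OF integrable_indicator_xi_measure integrable_even_power_xi_measure[OF n]])
    show "indicator {1..2} u \<le> u ^ n" for u :: real
      using zero_le_even_power[OF n, of u] one_le_power[of u n] by (auto simp: indicator_def)
  qed
  ultimately have "c \<le> xi_moment n" if "even n" for n using that by fastforce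
  moreover have "c > 0" by (simp add: c_def)
  ultimately show ?thesis by blast
qed

text \<open>Beyond \<open>u = ln m\<close> the density is so small that this part of the moment is negligible.\<close>

lemma xi_moment_ratio:
  "\<forall>\<^sub>F m in sequentially. xi_moment (2 * Suc m) \<le> ((ln (real (Suc m)))\<^sup>2 + 1) * xi_moment (2 * m)"
proof -
  define E where "E = (LINT u|xi_measure. exp (exp (2 * u)))"
  obtain \<delta> where \<delta>: "\<delta> > 0" "\<And>n. even n \<Longrightarrow> \<delta> \<le> xi_moment n"
    using xi_moment_lower_bound by blast
  \<comment> \<open>For u > ln(m+1) one has u^(2m+2) \<le> (2m+2)! exp(u). One half of exp(2u)
    exceeds u, the other is at least (m+1)^2/2; hence the bound
    \<open>K m * exp (exp (2 * u))\<close>. The Gaussian factor beats the factorial, so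
    \<open>K\<close> tends to 0.\<close>
  define K where "K m = fact (2 * Suc m) * exp (- ((real (Suc m))\<^sup>2 / 2))" for m
  have K0: "K m \<ge> 0" for m by (simp add: K_def)
  have main: "xi_moment (2 * Suc m) \<le> (ln (real (Suc m)))\<^sup>2 * xi_moment (2 * m) + K m * E" for m
  proof -
    have "xi_moment (2 * Suc m) \<le> (LINT u|xi_measure. (ln (real (Suc m)))\<^sup>2 * u ^ (2 * m) + K m * exp (exp (2 * u)))"
      unfolding xi_moment_def
    proof (rule integral_mono_AE)
      show "integrable xi_measure (\<lambda>u. u ^ (2 * Suc m))"
        by (rule integrable_even_power_xi_measure) simp
      show "integrable xi_measure (\<lambda>u. (ln (real (Suc m)))\<^sup>2 * u ^ (2 * m) + K m * exp (exp (2 * u)))"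
        by (intro Bochner_Integration.integrable_add integrable_mult_right integrable_even_power_xi_measure
            integrable_exp_exp_xi_measure) simp
      show "AE u in xi_measure. u ^ (2 * Suc m) \<le> (ln (real (Suc m)))\<^sup>2 * u ^ (2 * m) + K m * exp (exp (2 * u))"
        using AE_xi_measure_nonneg
      proof eventually_elim
        case (elim u)
        show ?case
        proof (cases "u \<le> ln (real (Suc m))")
          case True
          have "u\<^sup>2 * u ^ (2 * m) \<le> (ln (real (Suc m)))\<^sup>2 * u ^ (2 * m)"
            using True elim by (intro mult_right_mono power_mono) auto
          moreover have "u ^ (2 * Suc m) = u\<^sup>2 * u ^ (2 * m)" by (simp add: power2_eq_square)
          moreover have "0 \<le> K m * exp (exp (2 * u))" using K0[of m] by simp
          ultimately show ?thesis by linarith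
        next
          case False
          have "exp (2 * ln (real (Suc m))) \<le> exp (2 * u)" using False by simp
          then have e1: "(real (Suc m))\<^sup>2 \<le> exp (2 * u)"
            by (simp add: exp_double del: of_nat_Suc)
          have e2: "1 + 2 * u \<le> exp (2 * u)" by (rule exp_ge_add_one_self)
          have "u ^ (2 * Suc m) \<le> fact (2 * Suc m) * cosh u"
            using even_power_le_cosh[of "2 * Suc m" u] by (simp add: field_simps del: fact_Suc mult_Suc_right power_Suc)
          also have "cosh u \<le> exp u"
            using elim by (simp add: cosh_field_def)
          also have "exp u \<le> exp (- ((real (Suc m))\<^sup>2 / 2) + exp (2 * u))"
            unfolding exp_le_cancel_iff using e1 e2 by linarith
          also have "\<dots> = exp (- ((real (Suc m))\<^sup>2 / 2)) * exp (exp (2 * u))" by (rule exp_add)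
          finally have "u ^ (2 * Suc m) \<le> K m * exp (exp (2 * u))"
            by (simp only: K_def mult.assoc) (simp only: fact_ge_zero mult_left_mono)
          moreover have "0 \<le> (ln (real (Suc m)))\<^sup>2 * u ^ (2 * m)" using elim by simp
          ultimately show ?thesis by linarith
        qed
      qed
    qed
    also have "\<dots> = (ln (real (Suc m)))\<^sup>2 * xi_moment (2 * m) + K m * E"
      unfolding xi_moment_def E_def
      by (subst Bochner_Integration.integral_add)
         (auto intro!: integrable_mult_right integrable_even_power_xi_measure integrable_exp_exp_xi_measure)
    finally show ?thesis .
  qed
  have "K \<longlonglongrightarrow> 0"
  proof (rule tendsto_sandwich[of "\<lambda>_. 0"])
    show "\<forall>\<^sub>F m in sequentially. K m \<le> (2 * real m + 2) powr (2 * real m + 2) * exp (- ((real m + 1)\<^sup>2 / 2))"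
    proof (intro always_eventually allI)
      fix m
      have "(fact (2 * Suc m) :: real) \<le> real ((2 * Suc m) ^ (2 * Suc m))"
        by (rule fact_le_power)
      also have "\<dots> = real (2 * Suc m) powr real (2 * Suc m)"
        unfolding of_nat_power by (rule powr_realpow[symmetric]) simp
      also have "real (2 * Suc m) = 2 * real m + 2" by simp
      finally show "K m \<le> (2 * real m + 2) powr (2 * real m + 2) * exp (- ((real m + 1)\<^sup>2 / 2))"
        unfolding K_def by (intro mult_mono) (auto simp: add_ac)
    qed
    show "(\<lambda>m. (2 * real m + 2) powr (2 * real m + 2) * exp (- ((real m + 1)\<^sup>2 / 2))) \<longlonglongrightarrow> 0"
      by real_asymp
  qed (use K0 in auto)
  then have "(\<lambda>m. K m * E) \<longlonglongrightarrow> 0 * E" by (intro tendsto_intros)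
  \<comment> \<open>The tail drops below the uniform lower bound of the moments, so it costs at most
    one further copy of \<open>xi_moment (2 * m)\<close>: the +1 in the statement.\<close>
  then have "\<forall>\<^sub>F m in sequentially. K m * E < \<delta>"
    using \<delta>(1) by (intro order_tendstoD(2)) auto
  then show ?thesis
  proof eventually_elim
    case (elim m)
    have "\<delta> \<le> xi_moment (2 * m)" by (rule \<delta>(2)) simp
    then show ?case using main[of m] elim by (simp add: distrib_right)
  qed
qed

lemma xi_moment_pos: "even n \<Longrightarrow> xi_moment n > 0"
  using xi_moment_lower_bound by (meson less_le_trans)

lemma xi_gamma_ratio:
  "\<forall>\<^sub>F m in sequentially. Re (xi_gamma m) > 0 \<and>
     Re (xi_gamma (Suc m)) \<le> (ln (real m))\<^sup>2 / (2 * real m) * Re (xi_gamma m)"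
proof -
  \<comment> \<open>\<open>R\<close> bounds the ratio of consecutive \<open>xi_coeff\<close>.
    Asymptotically (m+2) R(m) is ln^2 m / (4m), half of the target ln^2 m / (2m); this slack pays
    for the +1 and for the factor 1 - R(m)/4.\<close>
  define R where "R m = ((ln (real m + 1))\<^sup>2 + 1) / ((2 * real m + 2) * (2 * real m + 1))" for m :: nat
  have "\<forall>\<^sub>F m in sequentially. (real m + 2) * R m \<le> (ln (real m + 1))\<^sup>2 / (2 * (real m + 1)) * (1 - R m / 4)"
    unfolding R_def by real_asymp
  moreover have "\<forall>\<^sub>F m in sequentially. R m < 1"
    unfolding R_def by real_asymp
  ultimately have "\<forall>\<^sub>F m in sequentially. Re (xi_gamma (Suc m)) > 0 \<and>
     Re (xi_gamma (Suc (Suc m))) \<le> (ln (real (Suc m)))\<^sup>2 / (2 * real (Suc m)) * Re (xi_gamma (Suc m))"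
    using xi_moment_ratio
  proof eventually_elim
    case (elim m)
    have cpos: "xi_coeff k > 0" for k
      by (simp add: xi_coeff_def xi_moment_pos)
    have "xi_coeff (Suc m) = 4 * xi_moment (2 * Suc m) / ((2 * real m + 2) * (2 * real m + 1) * fact (2 * m))"
      by (simp add: xi_coeff_def algebra_simps)
    also have "\<dots> \<le> 4 * (((ln (real (Suc m)))\<^sup>2 + 1) * xi_moment (2 * m)) / ((2 * real m + 2) * (2 * real m + 1) * fact (2 * m))"
      using elim(3) by (intro divide_right_mono mult_left_mono) auto
    also have "\<dots> = R m * xi_coeff m"
      by (simp add: R_def xi_coeff_def add_ac)
    finally have c1: "xi_coeff (Suc m) \<le> R m * xi_coeff m" .
    define L where "L = (ln (real m + 1))\<^sup>2 / (2 * (real m + 1))"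
    have L0: "L \<ge> 0" by (simp add: L_def)
    have low: "xi_coeff m - xi_coeff (Suc m) / 4 \<ge> (1 - R m / 4) * xi_coeff m"
      using c1 by (simp add: algebra_simps)
    have pos: "(1 - R m / 4) * xi_coeff m > 0"
      using elim(2) cpos[of m] by simp
    have g1: "Re (xi_gamma (Suc m)) = fact (Suc m) * (xi_coeff m - xi_coeff (Suc m) / 4) / 2"
      unfolding xi_gamma_Suc by (simp only: Re_complex_of_real)
    have g2: "Re (xi_gamma (Suc (Suc m))) = fact (Suc (Suc m)) * (xi_coeff (Suc m) - xi_coeff (Suc (Suc m)) / 4) / 2"
      unfolding xi_gamma_Suc by (simp only: Re_complex_of_real)
    have gpos: "Re (xi_gamma (Suc m)) > 0"
      unfolding g1 using low pos by (simp del: fact_Suc)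
    \<comment> \<open>In the larger index the subtracted quarter is simply dropped; in the smaller
      one it is controlled through \<open>low\<close>.\<close>
    have "(real m + 2) * (xi_coeff (Suc m) - xi_coeff (Suc (Suc m)) / 4) \<le> (real m + 2) * (R m * xi_coeff m)"
      using c1 cpos[of "Suc (Suc m)"] by (intro mult_left_mono) auto
    also have "\<dots> = ((real m + 2) * R m) * xi_coeff m" by simp
    also have "\<dots> \<le> (L * (1 - R m / 4)) * xi_coeff m"
      using elim(1) cpos[of m] unfolding L_def by (intro mult_right_mono) auto
    also have "\<dots> = L * ((1 - R m / 4) * xi_coeff m)" by simp
    also have "\<dots> \<le> L * (xi_coeff m - xi_coeff (Suc m) / 4)"
      using low L0 by (intro mult_left_mono) auto
    finally have "fact (Suc m) / 2 * ((real m + 2) * (xi_coeff (Suc m) - xi_coeff (Suc (Suc m)) / 4)) \<le>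
        fact (Suc m) / 2 * (L * (xi_coeff m - xi_coeff (Suc m) / 4))"
      by (intro mult_left_mono) auto
    moreover have "fact (Suc (Suc m)) = (real m + 2) * (fact (Suc m) :: real)"
      by (subst fact_Suc) (simp del: fact_Suc add: add_ac)
    ultimately have "Re (xi_gamma (Suc (Suc m))) \<le> L * Re (xi_gamma (Suc m))"
      unfolding g1 g2 by (simp only:) (simp del: fact_Suc add: mult_ac)
    then show ?case using gpos by (simp add: L_def add_ac)
  qed
  then show ?thesis
    by (subst eventually_sequentially_Suc[symmetric])
qed

lemma xi_gamma_real:
  assumes "m > 0"
  shows "xi_gamma m = of_real (Re (xi_gamma m))"
proof -
  obtain k where "m = Suc k" using assms by (cases m) auto
  then show ?thesis by (simp only: xi_gamma_Suc Re_complex_of_real)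
qed

section \<open>Hyperbolicity\<close>

text \<open>The derivative is (2 - ln t) ln t / t^2, nonpositive from exp 2 on. Hence the ratio
  bound at n also serves for all later indices, which makes the coefficients decay geometrically
  from n.\<close>

lemma ln_square_over_self_decreasing:
  fixes x y :: real
  assumes "exp 2 \<le> x" "x \<le> y"
  shows "(ln y)\<^sup>2 / y \<le> (ln x)\<^sup>2 / x"
proof (rule DERIV_nonpos_imp_nonincreasing[OF assms(2)])
  fix t assume t: "x \<le> t" "t \<le> y"
  have t0: "t > 0" using assms(1) t(1) exp_gt_zero[of "2 :: real"] by linarith
  have "ln t \<ge> 2" using t0 assms(1) t(1) by (subst ln_ge_iff) auto
  then have "(2 - ln t) * ln t \<le> 0" by (intro mult_nonpos_nonneg) auto
  then have "(2 - ln t) * ln t / t\<^sup>2 \<le> 0" by (simp add: divide_nonpos_nonneg)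
  moreover have "((\<lambda>t. (ln t)\<^sup>2 / t) has_real_derivative (2 - ln t) * ln t / t\<^sup>2) (at t)"
    using t0 by (auto intro!: derivative_eq_intros simp: power2_eq_square field_simps)
  ultimately show "\<exists>d. ((\<lambda>t. (ln t)\<^sup>2 / t) has_real_derivative d) (at t) \<and> d \<le> 0" by blast
qed

text \<open>One binomial coefficient is absorbed by (d choose j) (d-j)! \<le> d!, the other is at
  most d^j. What remains is (d-1)! d^(1 + j - 3j/2), and the exponent 1 - j/2 is at most 0 from j =
  2 on.\<close>

lemma turan_term_bound:
  fixes r :: real
  assumes d: "d \<ge> 2" and j: "2 \<le> j" "j \<le> d" and r: "0 \<le> r" "r \<le> real d powr (- (3 / 4))"
  shows "fact (d - j) * (real (d choose j) * r ^ j)\<^sup>2 \<le> fact (d - 1)"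
proof -
  have "(d choose j) * fact (d - j) \<le> fact d"
  proof -
    have "fact j * fact (d - j) * (d choose j) = fact d" using j by (intro binomial_fact_lemma) auto
    moreover have "1 * ((d choose j) * fact (d - j)) \<le> fact j * ((d choose j) * fact (d - j))"
      by (intro mult_right_mono) (auto simp: fact_ge_1)
    ultimately show ?thesis by (simp add: mult_ac)
  qed
  then have b1: "real (d choose j) * fact (d - j) \<le> fact d"
    by (metis of_nat_fact of_nat_le_iff of_nat_mult)
  have b2: "real (d choose j) \<le> real d ^ j"
    using binomial_le_pow[OF j(2)] by (metis of_nat_le_iff of_nat_power)
  have fd: "(fact d :: real) = real d * fact (d - 1)" using d by (simp add: fact_reduce)
  have "r ^ j \<le> (real d powr (- (3 / 4))) ^ j" using r by (intro power_mono) auto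
  then have "(r ^ j)\<^sup>2 \<le> ((real d powr (- (3 / 4))) ^ j)\<^sup>2" using r by (intro power_mono) auto
  also have "\<dots> = real d powr (- (3 / 2) * real j)"
    using d by (simp add: powr_powr flip: powr_realpow power_mult powr_numeral)
  finally have rj: "(r ^ j)\<^sup>2 \<le> real d powr (- (3 / 2) * real j)" .
  have "fact (d - j) * (real (d choose j) * r ^ j)\<^sup>2 =
      (real (d choose j) * fact (d - j)) * real (d choose j) * (r ^ j)\<^sup>2"
    by (simp add: power2_eq_square)
  also have "\<dots> \<le> fact d * real d ^ j * real d powr (- (3 / 2) * real j)"
    using b1 b2 rj by (intro mult_mono) auto
  also have "\<dots> = fact (d - 1) * (real d powr 1 * real d powr (real j) * real d powr (- (3 / 2) * real j))"
    using d by (simp add: fd powr_realpow)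
  also have "real d powr 1 * real d powr (real j) * real d powr (- (3 / 2) * real j) = real d powr (1 + real j + - (3 / 2) * real j)"
    by (simp only: powr_add)
  also have "fact (d - 1) * \<dots> \<le> fact (d - 1) * (1 :: real)"
  proof (rule mult_left_mono)
    have "real d powr (1 + real j + - (3 / 2) * real j) \<le> real d powr 0"
      using d j by (intro powr_mono) auto
    then show "real d powr (1 + real j + - (3 / 2) * real j) \<le> 1" using d by simp
  qed simp
  finally show ?thesis by simp
qed

lemma sum_two_power_less:
  "(\<Sum>k\<le>m. (2 :: real) ^ k) < 2 ^ (m + 2)"
proof -
  have "(\<Sum>k\<le>m. (2 :: real) ^ k) = 2 ^ (m + 1) - 1"
    by (induction m) auto
  moreover have "(2 :: real) ^ (m + 1) \<le> 2 ^ (m + 2)"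
    by (intro power_increasing) auto
  ultimately show ?thesis by linarith
qed

lemma hyperbolic_jensen_hermite:
  assumes n: "n > 0" and pos: "Re (xi_gamma n) > 0"
    and r: "0 \<le> r" "r \<le> real d powr (- (3 / 4))" and d: "d \<ge> 2"
    and nonneg: "\<And>j. 0 \<le> Re (xi_gamma (n + j))"
    and bound: "\<And>j. Re (xi_gamma (n + j)) \<le> r ^ j * Re (xi_gamma n)"
  shows "hyperbolic (jensen_hermite d n)"
proof -
  define g where "g j = Re (xi_gamma (n + j))" for j
  define a where "a k = real (d choose (d - k)) * g (d - k)" for k
  obtain m where m: "d = m + 2" using d by (metis add.commute le_Suc_ex)
  have "jensen_hermite d n = (\<Sum>j\<le>d. smult (of_real (a (d - j))) (hermite (d - j)))"
    unfolding jensen_hermite_def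
  proof (rule sum.cong[OF refl])
    fix j assume "j \<in> {..d}"
    then show "smult (of_nat (d choose j) * xi_gamma (n + j)) (hermite (d - j)) =
        smult (of_real (a (d - j))) (hermite (d - j))"
      using xi_gamma_real[of "n + j"] n by (simp add: a_def g_def)
  qed
  also have "\<dots> = (\<Sum>k\<le>m + 2. smult (of_real (a k)) (hermite k))"
    unfolding m[symmetric] by (rule sum.reindex_bij_witness[of _ "\<lambda>k. d - k" "\<lambda>j. d - j"]) auto
  finally have eq: "jensen_hermite d n = (\<Sum>k\<le>m + 2. smult (of_real (a k)) (hermite k))" .
  have ad: "a (m + 2) = g 0" using m by (simp add: a_def)
  have g0: "g 0 > 0" using pos by (simp add: g_def)
  \<comment> \<open>Each term is compared with the leading one without its power of two; the
    remaining powers 2^k form a geometric sum below 2^(m+2).\<close>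
  have "(\<Sum>k\<le>m. 2 ^ k * fact k * (a k)\<^sup>2) \<le> (\<Sum>k\<le>m. 2 ^ k * (fact (m + 1) * (g 0)\<^sup>2))"
  proof (rule sum_mono)
    fix k assume "k \<in> {..m}"
    define j where "j = d - k"
    have j: "2 \<le> j" "j \<le> d" "d - j = k" using \<open>k \<in> {..m}\<close> m by (auto simp: j_def)
    have "a k \<le> real (d choose j) * (r ^ j * g 0)"
      using bound[of j] by (auto simp: a_def j_def g_def intro!: mult_left_mono)
    moreover have "0 \<le> a k" using nonneg by (simp add: a_def g_def)
    ultimately have "(a k)\<^sup>2 \<le> (real (d choose j) * (r ^ j * g 0))\<^sup>2" by (intro power_mono)
    then have "fact k * (a k)\<^sup>2 \<le> fact k * (real (d choose j) * (r ^ j * g 0))\<^sup>2"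
      by (intro mult_left_mono) auto
    also have "\<dots> = (fact (d - j) * (real (d choose j) * r ^ j)\<^sup>2) * (g 0)\<^sup>2"
      by (simp add: j(3) power_mult_distrib)
    also have "\<dots> \<le> fact (d - 1) * (g 0)\<^sup>2"
      using turan_term_bound[OF d j(1,2) r] by (intro mult_right_mono) auto
    finally have "fact k * (a k)\<^sup>2 \<le> fact (m + 1) * (g 0)\<^sup>2" by (simp add: m)
    then show "2 ^ k * fact k * (a k)\<^sup>2 \<le> 2 ^ k * (fact (m + 1) * (g 0)\<^sup>2)"
      by (simp only: mult.assoc) (simp del: fact_Suc)
  qed
  also have "\<dots> = (\<Sum>k\<le>m. 2 ^ k) * (fact (m + 1) * (g 0)\<^sup>2)"
    by (simp only: sum_distrib_right)
  also have "\<dots> < 2 ^ (m + 2) * (fact (m + 1) * (g 0)\<^sup>2)"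
    using g0 by (intro mult_strict_right_mono sum_two_power_less mult_pos_pos) auto
  finally have "(\<Sum>k\<le>m. 2 ^ k * fact k * (a k)\<^sup>2) < 2 ^ (m + 2) * fact (m + 1) * (a (m + 2))\<^sup>2"
    unfolding ad by (simp only: mult.assoc)
  moreover have "a (m + 2) > 0" using g0 by (simp only: ad)
  ultimately show ?thesis unfolding eq by (intro turan_hermite)
qed

theorem theorem1p3:
  shows "\<forall>\<^sub>F d :: nat in sequentially. \<forall>n :: nat.
           real n / (ln (real n))\<^sup>2 \<ge> real d powr (3 / 4) / 2 \<longrightarrow>
           hyperbolic (jensen_hermite d n)"
proof -
  obtain m0 where m0: "\<And>m. m \<ge> m0 \<Longrightarrow> Re (xi_gamma m) > 0"
      "\<And>m. m \<ge> m0 \<Longrightarrow> Re (xi_gamma (Suc m)) \<le> (ln (real m))\<^sup>2 / (2 * real m) * Re (xi_gamma m)"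
    using xi_gamma_ratio unfolding eventually_sequentially by blast
  \<comment> \<open>Beyond \<open>N\<close> both the ratio estimate for the coefficients and the
    monotonicity of ln^2 t / t are available.\<close>
  define N where "N = max m0 (nat \<lceil>exp 2 :: real\<rceil>)"
  \<comment> \<open>A common bound for the finitely many quotients with n < N, so a large
    \<open>d\<close> excludes those n. The conventional value of the quotient at n = 0 and n = 1 is
    0.\<close>
  define B where "B = (\<Sum>n<N. real n / (ln (real n))\<^sup>2)"
  have "filterlim (\<lambda>d. real d powr (3 / 4) / 2) at_top sequentially" by real_asymp
  then have "\<forall>\<^sub>F d in sequentially. real d powr (3 / 4) / 2 > B"
    unfolding filterlim_at_top_dense by blast
  then show ?thesis
    using eventually_ge_at_top[of 2]
  proof eventually_elim
    case (elim d)
    show ?case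
    proof (intro allI impI)
      fix n assume le: "real d powr (3 / 4) / 2 \<le> real n / (ln (real n))\<^sup>2"
      have nN: "n \<ge> N"
      proof (rule ccontr)
        assume "\<not> n \<ge> N"
        then have "real n / (ln (real n))\<^sup>2 \<le> B"
          unfolding B_def by (intro member_le_sum[of n]) auto
        then show False using le elim by linarith
      qed
      then have n: "exp 2 \<le> real n" by (simp add: N_def)
      have n1: "real n > 1" using n exp_gt_one[of "2 :: real"] by linarith
      have lnpos: "ln (real n) > 0" using n1 by simp
      \<comment> \<open>With this \<open>r\<close> the hypothesis reads d^(3/4) / 2 \<le> 1/(2r),
        which is r \<le> d^(-3/4).\<close>
      define r where "r = (ln (real n))\<^sup>2 / (2 * real n)"
      have rpos: "r > 0" using lnpos n1 by (simp add: r_def)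
      have "real n / (ln (real n))\<^sup>2 = 1 / (2 * r)" using n1 lnpos by (simp add: r_def)
      then have "real d powr (3 / 4) \<le> 1 / r" using le by simp
      then have "r \<le> 1 / real d powr (3 / 4)"
        using rpos elim by (simp add: field_simps)
      then have r: "r \<le> real d powr (- (3 / 4))" by (simp add: powr_minus_divide)
      have gpos: "Re (xi_gamma (n + j)) > 0" for j
        using nN by (intro m0(1)) (simp add: N_def)
      have bound: "Re (xi_gamma (n + j)) \<le> r ^ j * Re (xi_gamma n)" for j
      proof (induction j)
        case (Suc j)
        have "Re (xi_gamma (n + Suc j)) \<le> (ln (real (n + j)))\<^sup>2 / (2 * real (n + j)) * Re (xi_gamma (n + j))"
          using m0(2)[of "n + j"] nN by (simp add: N_def)
        also have "\<dots> \<le> r * Re (xi_gamma (n + j))"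
        proof (rule mult_right_mono)
          have "(ln (real (n + j)))\<^sup>2 / real (n + j) \<le> (ln (real n))\<^sup>2 / real n"
            using n by (intro ln_square_over_self_decreasing) auto
          moreover have "a / (2 * b) = a / b / 2" for a b :: real by simp
          ultimately show "(ln (real (n + j)))\<^sup>2 / (2 * real (n + j)) \<le> r"
            unfolding r_def by (simp only: divide_right_mono zero_le_numeral)
        qed (use gpos[of j] in simp)
        also have "\<dots> \<le> r * (r ^ j * Re (xi_gamma n))"
          using Suc rpos by (intro mult_left_mono) auto
        finally show ?case by simp
      qed simp
      show "hyperbolic (jensen_hermite d n)"
        using gpos[of 0] gpos n1 rpos r elim bound
        by (intro hyperbolic_jensen_hermite[of n r d]) (auto intro: less_imp_le)
    qed
  qed
qed

end
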